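(* Let $h:U\subset\mathbb{C}\to\mathbb{C}$ be a complex function defined in an open set $U$ of the complex plane. If there exists a non-negative real function $\varphi\in L^p_{loc}(U)$, $p>2$, such that $$\left|\frac{\partial h}{\partial\bar z}\right|\le \varphi(z)\,G(|h(z)|),$$ where $G:[0,\infty)\to[0,\infty)$ is a locally integrable function such that $\limsup_{t\to0^+}G(t)/t<\infty$, then on each connected component of $U$ which contains a zero of $h$, either $h\equiv0$ or the zeroes of $h$ are isolated.
   Context: For $z=u+iv$, $\frac{\partial}{\partial\bar z}=\frac12\left(\frac{\partial}{\partial u}+i\frac{\partial}{\partial v}\right)$.
   Formalization: The function h is assumed real differentiable at every point of U; with mere existence of partial derivatives the claim fails, e.g. for h(z)=sin(1/z)exp(-1/z^4), h(0)=0. The inequality is required only almost everywhere. *)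

theory Defs
  imports "HOL-Analysis.Analysis"
begin

definition dzbar :: "(complex \<Rightarrow> complex) \<Rightarrow> complex \<Rightarrow> complex" where
  "dzbar h z =
     (vector_derivative (\<lambda>u. h (Complex u (Im z))) (at (Re z))
      + \<i> * vector_derivative (\<lambda>v. h (Complex (Re z) v)) (at (Im z))) / 2"

text \<open>
  Locally \<open>L\<^sup>p\<close> functions for \<open>1 \<le> p < \<infinity>\<close>, as functions rather than classes modulo null sets.
  The set \<open>S\<close> need not be open: for \<open>S = {0..}\<close> integrability is required up to the endpoint.
\<close>
definition Lp_loc :: "real \<Rightarrow> 'a::euclidean_space set \<Rightarrow> ('a \<Rightarrow> real) set" where
  "Lp_loc p S =
     {f. f \<in> borel_measurable (lebesgue_on S) \<and>
         (\<forall>K. compact K \<and> K \<subseteq> S \<longrightarrow> set_integrable lebesgue K (\<lambda>x. \<bar>f x\<bar> powr p))}"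

end

theory Submission
  imports Defs
begin

text \<open>
  Carleman's argument. Write \<open>D = \<partial>h/\<partial>z\<^sup>-\<close>. Near a zero \<open>a\<close> of \<open>h\<close> the growth condition on \<open>G\<close> gives
  \<open>|D| \<le> \<Phi> |h|\<close> almost everywhere with \<open>\<Phi> \<in> L\<^sup>p\<close>; on the zero set itself, where \<open>G(0)\<close> is
  arbitrary, \<open>D\<close> vanishes almost everywhere. Let \<open>u\<close> be \<open>h\<close> times a cutoff that is \<open>1\<close> on the disc of radius \<open>R\<close>
  about \<open>a\<close>. If \<open>u / (z - a)\<^sup>n\<close> is bounded and \<open>a\<close> is a limit of further zeros, then
  subtracting the Cauchy--Pompeiu formula at \<open>a\<close> from that at \<open>\<zeta>\<close> and using that
  \<open>p > 2\<close> makes \<open>\<integral> \<Phi>(z) / |z - \<zeta>|\<close> small on small discs, one gets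
  \<open>|u(\<zeta>)| \<le> K (|\<zeta> - a| / R)\<^sup>n\<^sup>+\<^sup>1\<close> with \<open>K\<close> independent of \<open>n\<close>. Iterating, \<open>h\<close> vanishes on the disc.

  Since \<open>h\<close> is merely differentiable, Green's formula is obtained as in Goursat's proof: the
  boundary integral over squares is a differentiable additive function, and
  a Henstock--Kurzweil gauge for the integrable derivative, together with a fine division into squares,
  identifies it with the integral.
\<close>

section \<open>The operator \<open>\<partial>/\<partial>z\<^sup>-\<close> at a point\<close>

text \<open>The obstacle is that D is only a pointwise derivative, with no integrability known in
  advance. The inequality |D| \<le> \<Phi> |h| is what supplies an integrable majorant for the
  Cauchy--Pompeiu integrand. Division by (z - a)^n leaves a function U that is merely bounded at a,
  so Green's formula has to tolerate finitely many points without differentiability. The further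
  zeros serve one purpose in each round: the formula at such a zero \<zeta> gives an integral equal
  to 0, and letting \<zeta> tend to a shows that the integral with pole a is 0 as well. Subtracting
  it brings out the factor \<zeta> - a. The threshold \<open>bump_mass / 4\<close> for the kernel
  integrals turns a bound M for |U| / |z - a| into (M + K') / 2, hence M \<le> K', where K' comes
  from the cutoff alone and the previous bound has dropped out.\<close>

definition has_dbar :: "(complex \<Rightarrow> complex) \<Rightarrow> complex \<Rightarrow> complex \<Rightarrow> bool" where
  "has_dbar f d z \<longleftrightarrow> (\<exists>L. (f has_derivative L) (at z) \<and> d = (L 1 + \<i> * L \<i>) / 2)"

lemma has_dbar_dzbar:
  assumes "h differentiable (at z)"
  shows "has_dbar h (dzbar h z) z"
proof -
  obtain L where L: "(h has_derivative L) (at z)"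
    using assms by (auto simp: differentiable_def)
  have lin: "linear L" using L has_derivative_linear by blast
  have "((\<lambda>u. Complex u (Im z)) has_vector_derivative 1) (at (Re z))"
    unfolding has_vector_derivative_def Complex_eq
    by (auto intro!: derivative_eq_intros simp: scaleR_conv_of_real)
  then have "((h \<circ> (\<lambda>u. Complex u (Im z))) has_vector_derivative L 1) (at (Re z))"
    by (intro vector_derivative_diff_chain_within)
      (auto intro: has_derivative_at_withinI L)
  then have 1: "vector_derivative (\<lambda>u. h (Complex u (Im z))) (at (Re z)) = L 1"
    by (simp add: vector_derivative_at o_def)
  have "((\<lambda>v. Complex (Re z) v) has_vector_derivative \<i>) (at (Im z))"
    unfolding has_vector_derivative_def Complex_eq
    by (auto intro!: derivative_eq_intros simp: scaleR_conv_of_real)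
  then have "((h \<circ> (\<lambda>v. Complex (Re z) v)) has_vector_derivative L \<i>) (at (Im z))"
    by (intro vector_derivative_diff_chain_within)
      (auto intro: has_derivative_at_withinI L)
  then have 2: "vector_derivative (\<lambda>v. h (Complex (Re z) v)) (at (Im z)) = L \<i>"
    by (simp add: vector_derivative_at o_def)
  show ?thesis unfolding has_dbar_def dzbar_def 1 2 using L by blast
qed

lemma has_dbar_continuous: "has_dbar f d z \<Longrightarrow> isCont f z"
  unfolding has_dbar_def using has_derivative_continuous by blast

lemma has_dbar_diff:
  assumes "has_dbar f d z" "has_dbar g e z"
  shows "has_dbar (\<lambda>w. f w - g w) (d - e) z"
proof -
  obtain L M where L: "(f has_derivative L) (at z)" "d = (L 1 + \<i> * L \<i>) / 2"
    and M: "(g has_derivative M) (at z)" "e = (M 1 + \<i> * M \<i>) / 2"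
    using assms unfolding has_dbar_def by blast
  have "((\<lambda>w. f w - g w) has_derivative (\<lambda>w. L w - M w)) (at z)"
    using L M by (auto intro: derivative_intros)
  then show ?thesis unfolding has_dbar_def L(2) M(2)
    by (intro exI[of _ "\<lambda>w. L w - M w"]) (auto simp: field_simps)
qed

lemma has_dbar_mult:
  assumes "has_dbar f d z" "has_dbar g e z"
  shows "has_dbar (\<lambda>w. f w * g w) (d * g z + f z * e) z"
proof -
  obtain L M where L: "(f has_derivative L) (at z)" "d = (L 1 + \<i> * L \<i>) / 2"
    and M: "(g has_derivative M) (at z)" "e = (M 1 + \<i> * M \<i>) / 2"
    using assms unfolding has_dbar_def by blast
  have "((\<lambda>w. f w * g w) has_derivative (\<lambda>w. f z * M w + L w * g z)) (at z)"
    using L M by (auto intro: derivative_intros)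
  then show ?thesis unfolding has_dbar_def L(2) M(2)
    by (intro exI[of _ "\<lambda>w. f z * M w + L w * g z"]) (auto simp: field_simps)
qed

lemma has_dbar_holomorphic:
  assumes "(f has_field_derivative f') (at z)"
  shows "has_dbar f 0 z"
  using assms unfolding has_dbar_def has_field_derivative_def
  by (intro exI[of _ "(*) f'"]) (auto simp: algebra_simps)

lemma has_dbar_const: "has_dbar (\<lambda>w. c) 0 z"
  by (rule has_dbar_holomorphic) (rule DERIV_const)

text \<open>|w - a|^2 is w - a times its conjugate, so its zbar derivative is w - a, and the chain
  rule adds the factor \<open>b\<close>. Using the squared distance keeps radial cutoffs
  differentiable at their centre.\<close>

lemma has_dbar_radial:
  assumes "(\<beta> has_real_derivative b) (at ((cmod (z - a))\<^sup>2))"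
  shows "has_dbar (\<lambda>w. of_real (\<beta> ((cmod (w - a))\<^sup>2))) (of_real b * (z - a)) z"
proof -
  have "((\<lambda>w. (cmod (w - a))\<^sup>2) has_derivative (\<lambda>t. 2 * ((z - a) \<bullet> t))) (at z)"
    unfolding dot_square_norm[symmetric]
    by (auto intro!: derivative_eq_intros simp: inner_commute)
  then have "((\<lambda>w. \<beta> ((cmod (w - a))\<^sup>2)) has_derivative (\<lambda>t. b * (2 * ((z - a) \<bullet> t)))) (at z)"
    by (rule has_derivative_compose) (rule assms[unfolded has_field_derivative_def])
  then have "((\<lambda>w. of_real (\<beta> ((cmod (w - a))\<^sup>2)) :: complex) has_derivative
      (\<lambda>t. of_real (b * (2 * ((z - a) \<bullet> t))))) (at z)"
    by (rule has_derivative_of_real)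
  then show ?thesis unfolding has_dbar_def
    by (intro exI[of _ "\<lambda>t. of_real (b * (2 * ((z - a) \<bullet> t)))"])
      (auto simp: inner_complex_def complex_eq_iff)
qed

lemma has_dbar_transform:
  assumes "has_dbar f d z" "open S" "z \<in> S" "\<And>w. w \<in> S \<Longrightarrow> f w = g w"
  shows "has_dbar g d z"
proof -
  obtain L where "(f has_derivative L) (at z)" "d = (L 1 + \<i> * L \<i>) / 2"
    using assms(1) unfolding has_dbar_def by blast
  with has_derivative_transform_within_open[OF this(1) assms(2,3,4)] show ?thesis
    unfolding has_dbar_def by blast
qed

lemma has_dbar_unique: "has_dbar f d z \<Longrightarrow> has_dbar f e z \<Longrightarrow> d = e"
  unfolding has_dbar_def using has_derivative_unique by blast

text \<open>For dividing out a simple pole: if \<open>f z = 0\<close>, the quotient of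
  \<open>f\<close> by w - z stays bounded near \<open>z\<close>.\<close>

lemma has_dbar_bound_quotient:
  assumes "has_dbar f d z"
  obtains C e where "e > 0" "C \<ge> 0" "\<And>w. cmod (w - z) < e \<Longrightarrow> cmod (f w - f z) \<le> C * cmod (w - z)"
proof -
  obtain L where L: "(f has_derivative L) (at z)" using assms unfolding has_dbar_def by blast
  then have bl: "bounded_linear L" and
    "\<exists>d>0. \<forall>y. norm (y - z) < d \<longrightarrow> norm (f y - f z - L (y - z)) \<le> 1 * norm (y - z)"
    unfolding has_derivative_at_alt using zero_less_one by blast+
  then obtain d where d: "d > 0" "\<And>y. norm (y - z) < d \<Longrightarrow> norm (f y - f z - L (y - z)) \<le> norm (y - z)"
    by auto
  obtain K where K: "K \<ge> 0" "\<And>x. norm (L x) \<le> norm x * K"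
    using bounded_linear.nonneg_bounded[OF bl] by blast
  show ?thesis
  proof (rule that[of d "K + 1"])
    fix w assume "cmod (w - z) < d"
    from d(2)[OF this] have "norm (f w - f z) \<le> norm (w - z) + norm (L (w - z))"
      by (smt (verit) norm_triangle_sub)
    also have "\<dots> \<le> norm (w - z) + norm (w - z) * K" using K(2) by (intro add_left_mono) auto
    finally show "cmod (f w - f z) \<le> (K + 1) * cmod (w - z)" by (simp add: algebra_simps)
  qed (use d K in auto)
qed

text \<open>With no continuity of the derivative at hand, measurability has to come from a limit of
  a sequence of difference quotients, here with steps 1/(n+1) in the directions 1 and \<i>.\<close>

lemma has_dbar_LIMSEQ:
  assumes "has_dbar f d z"
  shows "(\<lambda>n. (of_nat (Suc n) * (f (z + 1 / of_nat (Suc n)) - f z)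
     + \<i> * of_nat (Suc n) * (f (z + \<i> / of_nat (Suc n)) - f z)) / 2) \<longlonglongrightarrow> d"
proof -
  obtain L where L: "(f has_derivative L) (at z)" "d = (L 1 + \<i> * L \<i>) / 2"
    using assms unfolding has_dbar_def by blast
  have *: "(\<lambda>n. of_nat (Suc n) * (f (z + v / of_nat (Suc n)) - f z)) \<longlonglongrightarrow> L v" for v
  proof -
    have "((\<lambda>t. z + t *\<^sub>R v) has_derivative (\<lambda>t. t *\<^sub>R v)) (at 0)"
      by (auto intro!: derivative_eq_intros)
    moreover have "(f has_derivative L) (at (z + 0 *\<^sub>R v))" using L by simp
    ultimately have "((\<lambda>t. f (z + t *\<^sub>R v)) has_derivative (\<lambda>t. L (t *\<^sub>R v))) (at 0)"
      by (rule has_derivative_compose)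
    then have "((\<lambda>t. f (z + t *\<^sub>R v)) has_vector_derivative L v) (at 0)"
      unfolding has_vector_derivative_def
      by (simp add: linear_cmul[OF has_derivative_linear[OF L(1)]])
    then have quot: "((\<lambda>t. norm ((1 / norm (t - 0)) *\<^sub>R
        (f (z + t *\<^sub>R v) - (f (z + 0 *\<^sub>R v) + (t - 0) *\<^sub>R L v)))) \<longlongrightarrow> 0) (at 0)"
      unfolding has_vector_derivative_def has_derivative_at_within by (intro tendsto_norm_zero) (simp add: diff_diff_add inverse_eq_divide)
    have "norm ((1 / norm (t - 0)) *\<^sub>R (f (z + t *\<^sub>R v) - (f (z + 0 *\<^sub>R v) + (t - 0) *\<^sub>R L v)))
        = norm ((1 / t) *\<^sub>R (f (z + t *\<^sub>R v) - f z) - L v)" if "t \<noteq> 0" for t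
    proof -
      have "(1 / t) *\<^sub>R (f (z + t *\<^sub>R v) - f z) - L v
          = (1 / t) *\<^sub>R (f (z + t *\<^sub>R v) - (f (z + 0 *\<^sub>R v) + (t - 0) *\<^sub>R L v))"
        using that by (simp add: algebra_simps)
      then show ?thesis by simp
    qed
    then have "((\<lambda>t. norm ((1 / t) *\<^sub>R (f (z + t *\<^sub>R v) - f z) - L v)) \<longlongrightarrow> 0) (at 0)"
      by (intro Lim_transform_eventually[OF quot]) (auto simp: eventually_at_filter)
    then have lim: "((\<lambda>t. (1 / t) *\<^sub>R (f (z + t *\<^sub>R v) - f z)) \<longlongrightarrow> L v) (at 0)"
      by (simp add: tendsto_norm_zero_iff LIM_zero_iff)
    have "filterlim (\<lambda>n. 1 / real (Suc n)) (at 0) sequentially"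
      unfolding filterlim_at using LIMSEQ_inverse_real_of_nat
      by (auto simp: inverse_eq_divide)
    from filterlim_compose[OF lim this] show ?thesis
      by (simp add: scaleR_conv_of_real)
  qed
  show ?thesis unfolding L(2)
    using tendsto_divide[OF tendsto_add[OF *[of 1] tendsto_mult_left[OF *[of \<i>], of \<i>]] tendsto_const[of 2]]
    by (simp add: mult.assoc)
qed

lemma has_dbar_measurable:
  assumes "f \<in> borel_measurable borel" "AE z in lebesgue. has_dbar f (g z) z"
  shows "g \<in> borel_measurable lebesgue"
proof -
  let ?s = "\<lambda>n z. (of_nat (Suc n) * (f (z + 1 / of_nat (Suc n)) - f z)
     + \<i> * of_nat (Suc n) * (f (z + \<i> / of_nat (Suc n)) - f z)) / 2"
  have [measurable]: "f \<in> borel_measurable borel" by fact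
  have m: "?s n \<in> borel_measurable borel" for n
    by measurable
  define l where "l = (\<lambda>z. lim (\<lambda>n. ?s n z))"
  have "l \<in> borel_measurable borel" unfolding l_def
    by (intro borel_measurable_lim_metric m)
  then have "l \<in> borel_measurable lebesgue"
    by (simp add: measurable_completion)
  moreover have "AE z in lebesgue. g z = l z"
    using assms(2)
  proof eventually_elim
    case (elim z)
    from limI[OF has_dbar_LIMSEQ[OF this]] show ?case by (simp add: l_def)
  qed
  ultimately show ?thesis
    by (intro borel_measurable_AE[of l g]) (auto elim: AE_mp)
qed

section \<open>Green's formula for differentiable functions\<close>

abbreviation square :: "real \<Rightarrow> real \<Rightarrow> real \<Rightarrow> complex set" where
  "square x y s \<equiv> cbox (Complex x y) (Complex (x + s) (y + s))"

text \<open>A Cousin lemma: a square violating \<open>P\<close> has a quarter violating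
  \<open>P\<close>, and the nested bad quarters shrink to a point where \<open>loc\<close> fails.
  Only squares occur, so that estimates of order s^2 in the side s compare directly with
  area.\<close>

lemma square_quadrisection:
  assumes quad: "\<And>x y s. s > 0 \<Longrightarrow> P x y (s/2) \<Longrightarrow> P (x + s/2) y (s/2) \<Longrightarrow>
      P x (y + s/2) (s/2) \<Longrightarrow> P (x + s/2) (y + s/2) (s/2) \<Longrightarrow> P x y s"
    and loc: "\<And>z. \<exists>d>0. \<forall>x y s. 0 < s \<and> s < d \<and> z \<in> square x y s \<longrightarrow> P x y s"
    and "s > 0"
  shows "P x y s"
proof (rule ccontr)
  assume neg: "\<not> P x y s"
  have "\<exists>f. \<forall>n. (\<not> P (fst (f n)) (snd (f n)) (s / 2 ^ n)) \<and>
     square (fst (f (Suc n))) (snd (f (Suc n))) (s / 2 ^ Suc n)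
       \<subseteq> square (fst (f n)) (snd (f n)) (s / 2 ^ n)"
  proof (rule dependent_nat_choice)
    show "\<exists>q. \<not> P (fst q) (snd q) (s / 2 ^ 0)" using neg by auto
  next
    fix q :: "real \<times> real" and n
    define t where "t = s / 2 ^ n"
    have t: "t > 0" "s / 2 ^ Suc n = t / 2" using \<open>s > 0\<close> by (auto simp: t_def)
    assume "\<not> P (fst q) (snd q) (s / 2 ^ n)"
    then have "\<not> P (fst q) (snd q) t" by (simp add: t_def)
    then have "\<exists>a\<in>{0, t/2}. \<exists>b\<in>{0, t/2}. \<not> P (fst q + a) (snd q + b) (t/2)"
      using quad[OF t(1), of "fst q" "snd q"] by auto
    then obtain a b where ab: "a \<in> {0, t/2}" "b \<in> {0, t/2}" "\<not> P (fst q + a) (snd q + b) (t/2)"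
      by blast
    show "\<exists>q'. \<not> P (fst q') (snd q') (s / 2 ^ Suc n) \<and>
      square (fst q') (snd q') (s / 2 ^ Suc n) \<subseteq> square (fst q) (snd q) (s / 2 ^ n)"
      unfolding t(2) t_def[symmetric]
      using ab t(1) by (intro exI[of _ "(fst q + a, snd q + b)"]) (auto simp: in_cbox_complex_iff)
  qed
  then obtain f where f: "\<And>n. \<not> P (fst (f n)) (snd (f n)) (s / 2 ^ n)"
    "\<And>n. square (fst (f (Suc n))) (snd (f (Suc n))) (s / 2 ^ Suc n)
       \<subseteq> square (fst (f n)) (snd (f n)) (s / 2 ^ n)" by blast
  have "\<Inter>(range (\<lambda>n. square (fst (f n)) (snd (f n)) (s / 2 ^ n))) \<noteq> {}"
  proof (rule compact_nest)
    show "square (fst (f n)) (snd (f n)) (s / 2 ^ n) \<noteq> {}" for n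
    proof -
      have "Complex (fst (f n)) (snd (f n)) \<in> square (fst (f n)) (snd (f n)) (s / 2 ^ n)"
        using \<open>s > 0\<close> by (auto simp: in_cbox_complex_iff)
      then show ?thesis by blast
    qed
    show "square (fst (f n)) (snd (f n)) (s / 2 ^ n) \<subseteq> square (fst (f m)) (snd (f m)) (s / 2 ^ m)"
      if "m \<le> n" for m n
      by (rule lift_Suc_antimono_le[where f = "\<lambda>n. square (fst (f n)) (snd (f n)) (s / 2 ^ n)", OF f(2) that])
  qed auto
  then obtain z where z: "\<And>n. z \<in> square (fst (f n)) (snd (f n)) (s / 2 ^ n)" by auto
  obtain d where d: "d > 0" "\<And>x y s. 0 < s \<Longrightarrow> s < d \<Longrightarrow> z \<in> square x y s \<Longrightarrow> P x y s"
    using loc[of z] by blast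
  obtain n where "(1/2) ^ n < d / s"
    using real_arch_pow_inv[of "d/s" "1/2"] d(1) \<open>s > 0\<close> by auto
  then have "s / 2 ^ n < d" using \<open>s > 0\<close> by (simp add: field_simps)
  with d(2)[OF _ _ z[of n]] f(1)[of n] \<open>s > 0\<close> show False by simp
qed

text \<open>The counterclockwise contour integral of f dz around the rectangle, with opposite sides
  combined under one integral sign.\<close>

definition rect_integral :: "(complex \<Rightarrow> complex) \<Rightarrow> real \<Rightarrow> real \<Rightarrow> real \<Rightarrow> real \<Rightarrow> complex" where
  "rect_integral f x1 y1 x2 y2 =
     integral {x1..x2} (\<lambda>x. f (Complex x y1) - f (Complex x y2))
     + \<i> * integral {y1..y2} (\<lambda>y. f (Complex x2 y) - f (Complex x1 y))"

text \<open>Integrability on axis-parallel segments is a separate assumption because the formula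
  will be applied to bounded functions that may be discontinuous at finitely many points, where
  continuity cannot provide it.\<close>

locale line_integrable =
  fixes f :: "complex \<Rightarrow> complex"
  assumes hor: "\<And>y c d. (\<lambda>x. f (Complex x y)) integrable_on {c..d}"
    and ver: "\<And>x c d. (\<lambda>y. f (Complex x y)) integrable_on {c..d}"
begin

lemma rect_integral_split_hor:
  assumes "x1 \<le> m" "m \<le> x2"
  shows "rect_integral f x1 y1 x2 y2 = rect_integral f x1 y1 m y2 + rect_integral f m y1 x2 y2"
proof -
  have "integral {x1..x2} (\<lambda>x. f (Complex x y1) - f (Complex x y2)) =
      integral {x1..m} (\<lambda>x. f (Complex x y1) - f (Complex x y2)) +
      integral {m..x2} (\<lambda>x. f (Complex x y1) - f (Complex x y2))"
    by (rule Henstock_Kurzweil_Integration.integral_combine[symmetric])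
      (use assms in \<open>auto intro: integrable_diff hor\<close>)
  then show ?thesis
    by (simp add: rect_integral_def integral_diff[OF ver ver] algebra_simps)
qed

lemma rect_integral_split_ver:
  assumes "y1 \<le> m" "m \<le> y2"
  shows "rect_integral f x1 y1 x2 y2 = rect_integral f x1 y1 x2 m + rect_integral f x1 m x2 y2"
proof -
  have "integral {y1..y2} (\<lambda>y. f (Complex x2 y) - f (Complex x1 y)) =
      integral {y1..m} (\<lambda>y. f (Complex x2 y) - f (Complex x1 y)) +
      integral {m..y2} (\<lambda>y. f (Complex x2 y) - f (Complex x1 y))"
    by (rule Henstock_Kurzweil_Integration.integral_combine[symmetric])
      (use assms in \<open>auto intro: integrable_diff ver\<close>)
  then show ?thesis
    by (simp add: rect_integral_def integral_diff[OF hor hor] algebra_simps)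
qed

end

text \<open>The property carried through quadrisection. The permitted error is an integral of a
  weight, so errors of adjacent pieces add up to exactly what is permitted on their union.\<close>

definition approx_division where
  "approx_division \<gamma> g \<nu> I S \<longleftrightarrow> (\<exists>p. p tagged_division_of S \<and> \<gamma> fine p \<and>
     cmod (I - (\<Sum>(x,K)\<in>p. measure lborel K *\<^sub>R g x)) \<le> integral S \<nu>)"

lemma approx_division_Un:
  fixes g :: "complex \<Rightarrow> complex" and \<nu> :: "complex \<Rightarrow> real"
  assumes "approx_division \<gamma> g \<nu> I S" "approx_division \<gamma> g \<nu> J T"
    and "negligible (S \<inter> T)" "interior S \<inter> interior T = {}"
    and "\<nu> integrable_on S" "\<nu> integrable_on T"
  shows "approx_division \<gamma> g \<nu> (I + J) (S \<union> T)"
proof -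
  let ?s = "\<lambda>p. \<Sum>(x,K)\<in>p. measure lborel K *\<^sub>R g x"
  obtain p where p: "p tagged_division_of S" "\<gamma> fine p" "cmod (I - ?s p) \<le> integral S \<nu>"
    using assms(1) unfolding approx_division_def by blast
  obtain q where q: "q tagged_division_of T" "\<gamma> fine q" "cmod (J - ?s q) \<le> integral T \<nu>"
    using assms(2) unfolding approx_division_def by blast
  \<comment> \<open>The two divisions may share a tagged box, but such a box lies in both
    \<open>S\<close> and \<open>T\<close>, so it is degenerate and contributes 0.\<close>
  have "?s (p \<union> q) = ?s p + ?s q"
  proof (rule sum.union_inter_neutral)
    show "finite p" "finite q" using p q by (auto simp: tagged_division_of_def tagged_partial_division_of_def)
    show "\<forall>x\<in>p \<inter> q. (case x of (x, K) \<Rightarrow> measure lborel K *\<^sub>R g x) = 0"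
    proof safe
      fix x K assume xK: "(x, K) \<in> p" "(x, K) \<in> q"
      have "K \<subseteq> S" "K \<subseteq> T" using xK p(1) q(1) by (auto dest: tagged_division_ofD(3))
      then have "interior K = {}" using assms(4) interior_mono[of K S] interior_mono[of K T] by blast
      moreover obtain a b where "K = cbox a b" using tagged_division_ofD(4)[OF p(1) xK(1)] by blast
      ultimately show "measure lborel K *\<^sub>R g x = 0" using content_eq_0_interior[of a b] by (simp del: interior_cbox)
    qed
  qed
  then have "cmod (I + J - ?s (p \<union> q)) \<le> cmod (I - ?s p) + cmod (J - ?s q)"
    by (smt (verit) add_diff_add norm_triangle_ineq)
  also have "\<dots> \<le> integral (S \<union> T) \<nu>" using p(3) q(3) assms by simp
  finally show ?thesis unfolding approx_division_def
    using tagged_division_Un[OF p(1) q(1) assms(4)] fine_Un[OF p(2) q(2)] by blast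
qed

lemma cbox_complex_split_hor:
  assumes "x1 \<le> m" "m \<le> x2"
  shows "cbox (Complex x1 y1) (Complex x2 y2) = cbox (Complex x1 y1) (Complex m y2) \<union> cbox (Complex m y1) (Complex x2 y2)"
    "interior (cbox (Complex x1 y1) (Complex m y2)) \<inter> interior (cbox (Complex m y1) (Complex x2 y2)) = {}"
    "negligible (cbox (Complex x1 y1) (Complex m y2) \<inter> cbox (Complex m y1) (Complex x2 y2))"
proof -
  show "negligible (cbox (Complex x1 y1) (Complex m y2) \<inter> cbox (Complex m y1) (Complex x2 y2))"
    by (rule negligible_subset[OF negligible_hyperplane[of 1 m]])
      (auto simp: in_cbox_complex_iff inner_complex_def)
qed (use assms in \<open>auto simp: in_cbox_complex_iff in_box_complex_iff\<close>)

lemma cbox_complex_split_ver: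
  assumes "y1 \<le> m" "m \<le> y2"
  shows "cbox (Complex x1 y1) (Complex x2 y2) = cbox (Complex x1 y1) (Complex x2 m) \<union> cbox (Complex x1 m) (Complex x2 y2)"
    "interior (cbox (Complex x1 y1) (Complex x2 m)) \<inter> interior (cbox (Complex x1 m) (Complex x2 y2)) = {}"
    "negligible (cbox (Complex x1 y1) (Complex x2 m) \<inter> cbox (Complex x1 m) (Complex x2 y2))"
proof -
  show "negligible (cbox (Complex x1 y1) (Complex x2 m) \<inter> cbox (Complex x1 m) (Complex x2 y2))"
    by (rule negligible_subset[OF negligible_hyperplane[of \<i> m]])
      (auto simp: in_cbox_complex_iff inner_complex_def)
qed (use assms in \<open>auto simp: in_cbox_complex_iff in_box_complex_iff\<close>)

lemma content_square: "s \<ge> 0 \<Longrightarrow> measure lborel (square x y s) = s\<^sup>2"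
  by (subst content_cbox) (auto simp: Basis_complex_def inner_complex_def power2_eq_square)

text \<open>
  The weight \<open>\<nu>\<close> need not be bounded: it lets the local estimate fail by more than \<open>o(s\<^sup>2)\<close> at
  exceptional points.
\<close>

theorem (in line_integrable) rect_integral_square:
  fixes g :: "complex \<Rightarrow> complex" and \<nu> :: "complex \<Rightarrow> real"
  assumes g: "g integrable_on square x y s" and "s > 0"
    and \<nu>: "\<And>x y x' y'. \<nu> integrable_on cbox (Complex x y) (Complex x' y')"
    and loc: "\<And>z e. e > 0 \<Longrightarrow> \<exists>d>0. \<forall>x y s. 0 < s \<and> s < d \<and> z \<in> square x y s \<longrightarrow>
       cmod (rect_integral f x y (x+s) (y+s) - s\<^sup>2 *\<^sub>R g z) \<le> e * integral (square x y s) \<nu>"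
  shows "rect_integral f x y (x+s) (y+s) = integral (square x y s) g"
proof -
  let ?F = "\<lambda>x y s. rect_integral f x y (x+s) (y+s)"
  have key: "cmod (?F x y s - integral (square x y s) g) \<le> e * (1 + integral (square x y s) \<nu>)"
    if "e > 0" for e
  proof -
    obtain \<gamma> where \<gamma>: "gauge \<gamma>" "\<And>p. p tagged_division_of square x y s \<Longrightarrow> \<gamma> fine p \<Longrightarrow>
       norm ((\<Sum>(x,K)\<in>p. measure lborel K *\<^sub>R g x) - integral (square x y s) g) < e"
      using has_integral_integral[THEN iffD1, OF g] \<open>e > 0\<close> unfolding has_integral by meson
    let ?\<nu> = "\<lambda>z. e * \<nu> z"
    have int\<nu>: "?\<nu> integrable_on cbox (Complex x y) (Complex x' y')" for x y x' y'
      by (intro integrable_on_mult_right \<nu>)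
    have "approx_division \<gamma> g ?\<nu> (?F x y s) (square x y s)"
    proof (rule square_quadrisection[where P = "\<lambda>x y s. approx_division \<gamma> g ?\<nu> (?F x y s) (square x y s)"])
      fix x y s :: real
      assume "s > 0"
      define m n where "m = x + s/2" and "n = y + s/2"
      have eqs: "m + s/2 = x + s" "n + s/2 = y + s" by (auto simp: m_def n_def)
      have le: "x \<le> m" "m \<le> x + s" "y \<le> n" "n \<le> y + s" using \<open>s > 0\<close> by (auto simp: m_def n_def)
      assume "approx_division \<gamma> g ?\<nu> (?F x y (s/2)) (square x y (s/2))"
        "approx_division \<gamma> g ?\<nu> (?F (x + s/2) y (s/2)) (square (x + s/2) y (s/2))"
        "approx_division \<gamma> g ?\<nu> (?F x (y + s/2) (s/2)) (square x (y + s/2) (s/2))"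
        "approx_division \<gamma> g ?\<nu> (?F (x + s/2) (y + s/2) (s/2)) (square (x + s/2) (y + s/2) (s/2))"
      note A = this[unfolded m_def[symmetric] n_def[symmetric] eqs]
      have 1: "approx_division \<gamma> g ?\<nu> (rect_integral f x y (x+s) n) (cbox (Complex x y) (Complex (x+s) n))"
        unfolding rect_integral_split_hor[OF le(1,2)] cbox_complex_split_hor(1)[OF le(1,2)]
        by (intro approx_division_Un A int\<nu> cbox_complex_split_hor(2,3) le)
      have 2: "approx_division \<gamma> g ?\<nu> (rect_integral f x n (x+s) (y+s)) (cbox (Complex x n) (Complex (x+s) (y+s)))"
        unfolding rect_integral_split_hor[OF le(1,2)] cbox_complex_split_hor(1)[OF le(1,2)]
        by (intro approx_division_Un A int\<nu> cbox_complex_split_hor(2,3) le)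
      show "approx_division \<gamma> g ?\<nu> (?F x y s) (square x y s)"
        unfolding rect_integral_split_ver[OF le(3,4)] cbox_complex_split_ver(1)[OF le(3,4)]
        by (intro approx_division_Un 1 2 int\<nu> cbox_complex_split_ver(2,3) le)
    next
      fix z
      obtain d where d: "d > 0" "\<And>x y s. 0 < s \<Longrightarrow> s < d \<Longrightarrow> z \<in> square x y s \<Longrightarrow>
         cmod (?F x y s - s\<^sup>2 *\<^sub>R g z) \<le> e * integral (square x y s) \<nu>"
        using loc[OF \<open>e > 0\<close>, of z] by blast
      have "z \<in> \<gamma> z" "open (\<gamma> z)" using \<gamma>(1) by (auto simp: gauge_def)
      then obtain r where r: "r > 0" "ball z r \<subseteq> \<gamma> z" using openE by blast
      show "\<exists>d>0. \<forall>x y s. 0 < s \<and> s < d \<and> z \<in> square x y s \<longrightarrow>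
          approx_division \<gamma> g ?\<nu> (?F x y s) (square x y s)"
      proof (intro exI[of _ "min d (r/2)"] conjI allI impI)
        fix x y s assume s: "0 < s \<and> s < min d (r/2) \<and> z \<in> square x y s"
        have "square x y s \<subseteq> \<gamma> z"
        proof
          fix w assume "w \<in> square x y s"
          with s have "\<bar>Re (z - w)\<bar> \<le> s" "\<bar>Im (z - w)\<bar> \<le> s" by (auto simp: in_cbox_complex_iff)
          then have "dist z w < r" using cmod_le[of "z - w"] s unfolding dist_norm by linarith
          then show "w \<in> \<gamma> z" using r(2) by auto
        qed
        then have "\<gamma> fine {(z, square x y s)}" by (simp add: fine_def)
        moreover have "{(z, square x y s)} tagged_division_of square x y s"
          using s by (intro tagged_division_of_self) auto
        moreover have "cmod (?F x y s - (\<Sum>(x,K)\<in>{(z, square x y s)}. measure lborel K *\<^sub>R g x))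
            \<le> integral (square x y s) ?\<nu>"
          using d(2)[of s x y] s by (simp add: content_square)
        ultimately show "approx_division \<gamma> g ?\<nu> (?F x y s) (square x y s)"
          unfolding approx_division_def by (intro exI conjI)
      qed (use d r in auto)
    qed (use \<open>s > 0\<close> in auto)
    then obtain p where p: "p tagged_division_of square x y s" "\<gamma> fine p"
      "cmod (?F x y s - (\<Sum>(x,K)\<in>p. measure lborel K *\<^sub>R g x)) \<le> integral (square x y s) ?\<nu>"
      unfolding approx_division_def by (elim exE conjE)
    have "cmod (?F x y s - integral (square x y s) g)
      \<le> cmod (?F x y s - (\<Sum>(x,K)\<in>p. measure lborel K *\<^sub>R g x))
        + cmod ((\<Sum>(x,K)\<in>p. measure lborel K *\<^sub>R g x) - integral (square x y s) g)"
      by norm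
    also have "\<dots> \<le> e * integral (square x y s) \<nu> + e" using p(3) \<gamma>(2)[OF p(1,2)] by simp
    finally show ?thesis by (simp add: algebra_simps)
  qed
  have "cmod (?F x y s - integral (square x y s) g) \<le> 0 + e" if "e > 0" for e
  proof -
    define c where "c = 1 + \<bar>integral (square x y s) \<nu>\<bar>"
    have c: "c > 0" "1 + integral (square x y s) \<nu> \<le> c" by (auto simp: c_def)
    have "cmod (?F x y s - integral (square x y s) g) \<le> (e/c) * (1 + integral (square x y s) \<nu>)"
      using that c by (intro key) auto
    also have "\<dots> \<le> (e/c) * c" using that c by (intro mult_left_mono) auto
    finally show ?thesis using c by simp
  qed
  then have "cmod (?F x y s - integral (square x y s) g) \<le> 0" by (rule field_le_epsilon)
  then show ?thesis by simp
qed

section \<open>Integrability of negative powers of the distance\<close>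

lemma nn_integral_kernel_ball:
  fixes \<zeta> :: complex
  assumes q: "0 \<le> q" "q < 2" and r: "r > 0"
  shows "(\<integral>\<^sup>+w\<in>ball \<zeta> r. ennreal (cmod (w - \<zeta>) powr (-q)) \<partial>lebesgue)
    \<le> ennreal (4 * 2 powr q / (1 - 2 powr (q - 2)) * r powr (2 - q))"
proof -
  \<comment> \<open>Dyadic decomposition: on the annulus of radii r/2^(k+1) and r/2^k the kernel is
    at most \<open>c k\<close>, and the disc \<open>A k\<close> fits in a square of side 2r/2^k. The
    resulting geometric series has ratio 2^(q-2), below 1 because q < 2.\<close>
  define A where "A k = ball \<zeta> (r / 2 ^ k)" for k :: nat
  define c where "c k = (r / 2 ^ Suc k) powr (-q)" for k :: nat
  have Am: "A k \<in> sets lebesgue" for k by (auto simp: A_def)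
  have em: "emeasure lebesgue (A k) \<le> ennreal (4 * (r / 2 ^ k)\<^sup>2)" for k
  proof -
    define \<rho> where "\<rho> = r / 2 ^ k"
    have \<rho>: "\<rho> > 0" using r by (simp add: \<rho>_def)
    let ?S = "square (Re \<zeta> - \<rho>) (Im \<zeta> - \<rho>) (2 * \<rho>)"
    have "A k \<subseteq> ?S"
    proof
      fix w assume "w \<in> A k"
      then have "cmod (w - \<zeta>) < \<rho>" by (simp add: A_def \<rho>_def dist_norm norm_minus_commute)
      then have "\<bar>Re w - Re \<zeta>\<bar> < \<rho>" "\<bar>Im w - Im \<zeta>\<bar> < \<rho>"
        using abs_Re_le_cmod[of "w - \<zeta>"] abs_Im_le_cmod[of "w - \<zeta>"] by auto
      then show "w \<in> ?S" by (auto simp: in_cbox_complex_iff)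
    qed
    then have "emeasure lebesgue (A k) \<le> emeasure lebesgue ?S"
      by (intro emeasure_mono) auto
    also have "\<dots> = emeasure lborel ?S" by simp
    also have "\<dots> = ennreal (measure lborel ?S)"
      by (intro emeasure_eq_ennreal_measure less_imp_neq)
        (metis emeasure_lborel_cbox_finite infinity_ennreal_def)
    also have "measure lborel ?S = 4 * \<rho>\<^sup>2" using \<rho> by (subst content_square) (auto simp: power_mult_distrib)
    finally show ?thesis by (simp add: \<rho>_def)
  qed
  have pw: "ennreal (cmod (w - \<zeta>) powr (-q)) * indicator (ball \<zeta> r) w \<le> (\<Sum>k. ennreal (c k) * indicator (A k) w)" for w
  proof (cases "w \<in> ball \<zeta> r \<and> w \<noteq> \<zeta>")
    case True
    define d where "d = cmod (w - \<zeta>)"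
    have d: "d > 0" "d < r" using True by (auto simp: d_def dist_norm norm_minus_commute)
    obtain n where n: "(1/2) ^ n < d / r" using real_arch_pow_inv[of "d/r" "1/2"] d by auto
    \<comment> \<open>As d < r, this least index is positive; its predecessor is the index of the
      dyadic annulus containing \<open>w\<close>.\<close>
    define m where "m = (LEAST n. r / 2 ^ n \<le> d)"
    have ex: "r / 2 ^ n \<le> d" using n r d by (simp add: field_simps)
    have m1: "r / 2 ^ m \<le> d" unfolding m_def by (rule LeastI[of "\<lambda>n. r / 2 ^ n \<le> d", OF ex])
    have "m \<noteq> 0" using m1 d by (cases m) auto
    then obtain k where k: "m = Suc k" using not0_implies_Suc by blast
    have m2: "d < r / 2 ^ k"
      using not_less_Least[of k "\<lambda>n. r / 2 ^ n \<le> d"] k unfolding m_def[symmetric] by auto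
    have "d powr (-q) \<le> c k" unfolding c_def
      using m1 k d q r by (intro powr_mono2') auto
    moreover have "w \<in> A k" using m2 by (auto simp: A_def d_def dist_norm norm_minus_commute)
    ultimately have "ennreal (cmod (w - \<zeta>) powr (-q)) * indicator (ball \<zeta> r) w \<le> ennreal (c k) * indicator (A k) w"
      using True by (auto simp: d_def intro!: ennreal_leI)
    also have "\<dots> \<le> (\<Sum>k. ennreal (c k) * indicator (A k) w)"
      using sum_le_suminf[OF summableI, of "{k}" "\<lambda>k. ennreal (c k) * indicator (A k) w"] by (simp del: sum_mult_indicator)
    finally show ?thesis .
  qed auto
  have "(\<integral>\<^sup>+w\<in>ball \<zeta> r. ennreal (cmod (w - \<zeta>) powr (-q)) \<partial>lebesgue)
      \<le> (\<integral>\<^sup>+w. (\<Sum>k. ennreal (c k) * indicator (A k) w) \<partial>lebesgue)"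
    by (intro nn_integral_mono pw)
  also have "\<dots> = (\<Sum>k. \<integral>\<^sup>+w. ennreal (c k) * indicator (A k) w \<partial>lebesgue)"
    by (intro nn_integral_suminf borel_measurable_times_ennreal borel_measurable_indicator Am) auto
  also have "\<dots> = (\<Sum>k. ennreal (c k) * emeasure lebesgue (A k))"
    by (intro suminf_cong nn_integral_cmult_indicator Am)
  also have "\<dots> \<le> (\<Sum>k. ennreal (4 * 2 powr q * r powr (2 - q) * (2 powr (q - 2)) ^ k))"
  proof (intro suminf_le)
    fix k
    have "ennreal (c k) * emeasure lebesgue (A k) \<le> ennreal (c k) * ennreal (4 * (r / 2 ^ k)\<^sup>2)"
      by (intro mult_left_mono em) auto
    also have "\<dots> = ennreal (c k * (4 * (r / 2 ^ k)\<^sup>2))"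
      by (subst ennreal_mult) (auto simp: c_def)
    also have "c k * (4 * (r / 2 ^ k)\<^sup>2) = 4 * 2 powr q * r powr (2 - q) * (2 powr (q - 2)) ^ k"
    proof -
      have p2: "(2::real) ^ j = 2 powr j" for j by (simp add: powr_realpow)
      have "c k * (4 * (r / 2 ^ k)\<^sup>2) = 4 * ((r powr (-q) * r powr 2) * ((2 powr (real (Suc k))) powr q / (2 powr (real k)) powr 2))"
        unfolding c_def using r by (simp add: p2 powr_divide powr_minus_divide divide_simps del: power_Suc) 
      also have "r powr (-q) * r powr 2 = r powr (2 - q)" by (simp add: powr_add[symmetric])
      also have "(2 powr (real (Suc k))) powr q / (2 powr (real k)) powr 2 = 2 powr (real (Suc k) * q - real k * 2)"
        by (simp add: powr_powr powr_diff)
      also have "real (Suc k) * q - real k * 2 = q + (q - 2) * real k" by (simp add: algebra_simps)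
      also have "2 powr \<dots> = 2 powr q * (2 powr (q - 2)) ^ k" by (simp add: powr_add powr_powr[symmetric] powr_realpow)
      finally show ?thesis by (simp add: mult_ac)
    qed
    finally show "ennreal (c k) * emeasure lebesgue (A k) \<le> ennreal (4 * 2 powr q * r powr (2 - q) * (2 powr (q - 2)) ^ k)" .
  qed auto
  also have "\<dots> = ennreal (4 * 2 powr q * r powr (2 - q) * (1 / (1 - 2 powr (q - 2))))"
  proof (intro suminf_ennreal_eq sums_mult geometric_sums)
    have "2 powr (q - 2) < 2 powr (0::real)" using q by (intro powr_less_mono) auto
    then show "norm (2 powr (q - 2)) < 1" by simp
  qed auto
  finally show ?thesis by (simp add: mult_ac)
qed

lemma kernel_absolutely_integrable:
  fixes \<zeta> :: complex
  assumes q: "0 \<le> q" "q < 2" and S: "bounded S" "S \<in> sets lebesgue"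
  shows "(\<lambda>w. cmod (w - \<zeta>) powr (-q)) absolutely_integrable_on S"
proof -
  obtain r where r: "r > 0" "S \<subseteq> ball \<zeta> r"
    using bounded_subset_ballD[OF S(1)] by blast
  have "integrable lebesgue (\<lambda>w. indicator (ball \<zeta> r) w *\<^sub>R (cmod (w - \<zeta>) powr (-q)))"
  proof (rule integrableI_bounded)
    show "(\<lambda>w. indicator (ball \<zeta> r) w *\<^sub>R (cmod (w - \<zeta>) powr (-q))) \<in> borel_measurable lebesgue"
    proof -
      have "(\<lambda>w. cmod (w - \<zeta>) powr (-q)) \<in> borel_measurable borel" by measurable
      then show ?thesis
        by (intro measurable_completion borel_measurable_scaleR borel_measurable_indicator) auto
    qed
    have "(\<integral>\<^sup>+w. ennreal (norm (indicator (ball \<zeta> r) w *\<^sub>R (cmod (w - \<zeta>) powr (-q)))) \<partial>lebesgue)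
      = (\<integral>\<^sup>+w\<in>ball \<zeta> r. ennreal (cmod (w - \<zeta>) powr (-q)) \<partial>lebesgue)"
      by (intro nn_integral_cong) (auto simp: indicator_def)
    also have "\<dots> < \<infinity>"
      using nn_integral_kernel_ball[OF q r(1), of \<zeta>] by (simp add: order.strict_trans1)
    finally show "(\<integral>\<^sup>+w. ennreal (norm (indicator (ball \<zeta> r) w *\<^sub>R (cmod (w - \<zeta>) powr (-q)))) \<partial>lebesgue) < \<infinity>" .
  qed
  then have "(\<lambda>w. cmod (w - \<zeta>) powr (-q)) absolutely_integrable_on ball \<zeta> r"
    by (simp add: set_integrable_def)
  then show ?thesis using r(2) S(2) set_integrable_subset by blast
qed

text \<open>Only differences across opposite sides enter the contour integral. At a point of
  differentiability \<open>c\<close> and \<open>d\<close> will be the differences of the linear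
  part; at an exceptional point both are 0 and \<open>B\<close> comes from boundedness
  alone.\<close>

lemma (in line_integrable) rect_integral_square_bound:
  assumes "s \<ge> 0" "B \<ge> 0"
    and 1: "\<And>u. x \<le> u \<Longrightarrow> u \<le> x + s \<Longrightarrow> cmod (f (Complex u y) - f (Complex u (y+s)) - c) \<le> B"
    and 2: "\<And>v. y \<le> v \<Longrightarrow> v \<le> y + s \<Longrightarrow> cmod (f (Complex (x+s) v) - f (Complex x v) - d) \<le> B"
  shows "cmod (rect_integral f x y (x+s) (y+s) - s *\<^sub>R (c + \<i> * d)) \<le> 2 * B * s"
proof -
  let ?I = "integral {x..x+s} (\<lambda>u. f (Complex u y) - f (Complex u (y+s)))"
  let ?J = "integral {y..y+s} (\<lambda>v. f (Complex (x+s) v) - f (Complex x v))"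
  have c: "((\<lambda>u. c) has_integral (s *\<^sub>R c)) {x..x+s}" for c :: complex and x
    using has_integral_const_real[of c x "x+s"] \<open>s \<ge> 0\<close> by simp
  have "((\<lambda>u. f (Complex u y) - f (Complex u (y+s)) - c) has_integral (?I - s *\<^sub>R c)) {x..x+s}"
    by (intro has_integral_diff integrable_integral integrable_diff hor c)
  from has_integral_bound_real[OF \<open>B \<ge> 0\<close> finite.emptyI this] 1 \<open>s \<ge> 0\<close> have I: "cmod (?I - s *\<^sub>R c) \<le> B * s" by auto
  have "((\<lambda>v. f (Complex (x+s) v) - f (Complex x v) - d) has_integral (?J - s *\<^sub>R d)) {y..y+s}"
    by (intro has_integral_diff integrable_integral integrable_diff ver c)
  from has_integral_bound_real[OF \<open>B \<ge> 0\<close> finite.emptyI this] 2 \<open>s \<ge> 0\<close> have J: "cmod (?J - s *\<^sub>R d) \<le> B * s" by auto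
  have "rect_integral f x y (x+s) (y+s) - s *\<^sub>R (c + \<i> * d) = (?I - s *\<^sub>R c) + \<i> * (?J - s *\<^sub>R d)"
    by (simp add: rect_integral_def algebra_simps)
  also have "cmod \<dots> \<le> cmod (?I - s *\<^sub>R c) + cmod (\<i> * (?J - s *\<^sub>R d))" by (rule norm_triangle_ineq)
  also have "\<dots> \<le> 2 * B * s" using I J by (simp add: norm_mult)
  finally show ?thesis .
qed

lemma square_dist:
  assumes "z \<in> square x y s" "w \<in> square x y s" shows "cmod (w - z) \<le> 2 * s"
proof -
  have "\<bar>Re (w - z)\<bar> \<le> s" "\<bar>Im (w - z)\<bar> \<le> s" using assms by (auto simp: in_cbox_complex_iff)
  then show ?thesis using cmod_le[of "w - z"] by linarith
qed

text \<open>The constant part integrates to 0 and the linear part \<open>L\<close> to s^2 (\<i> L(1)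
  - L(\<i>)), which is 2 \<i> d s^2; the remainder is o(s) on a contour of length 4s.\<close>

lemma (in line_integrable) rect_integral_has_dbar:
  assumes "has_dbar f d z" "e > 0"
  shows "\<exists>\<delta>>0. \<forall>x y s. 0 < s \<and> s < \<delta> \<and> z \<in> square x y s \<longrightarrow>
     cmod (rect_integral f x y (x+s) (y+s) - s\<^sup>2 *\<^sub>R (2 * \<i> * d)) \<le> e * s\<^sup>2"
proof -
  obtain L where L: "(f has_derivative L) (at z)" "d = (L 1 + \<i> * L \<i>) / 2"
    using assms(1) unfolding has_dbar_def by blast
  have lin: "linear L" using L(1) has_derivative_linear by blast
  have "\<forall>e>0. \<exists>d>0. \<forall>w. norm (w - z) < d \<longrightarrow> norm (f w - f z - L (w - z)) \<le> e * norm (w - z)"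
    using L(1) unfolding has_derivative_at_alt by blast
  \<comment> \<open>The 8 pays for three factors 2: the distance bound \<open>square_dist\<close>,
    comparing two points of the square through \<open>z\<close>, and the 2 in
    \<open>rect_integral_square_bound\<close>.\<close>
  then obtain \<delta> where \<delta>: "\<delta> > 0" "\<And>w. norm (w - z) < \<delta> \<Longrightarrow> norm (f w - f z - L (w - z)) \<le> e/8 * norm (w - z)"
    using \<open>e > 0\<close> by (metis zero_less_divide_iff zero_less_numeral)
  show ?thesis
  proof (intro exI[of _ "\<delta>/2"] conjI allI impI)
    fix x y s assume s: "0 < s \<and> s < \<delta>/2 \<and> z \<in> square x y s"
    have err: "cmod (f v - f w - L (v - w)) \<le> e/2 * s" if "v \<in> square x y s" "w \<in> square x y s" for v w
    proof -
      have *: "norm (f w - f z - L (w - z)) \<le> e/4 * s" if "w \<in> square x y s" for w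
      proof -
        have "norm (w - z) \<le> 2 * s" using square_dist s that by blast
        then have "norm (f w - f z - L (w - z)) \<le> e/8 * norm (w - z)" using \<delta>(2)[of w] s by auto
        also have "\<dots> \<le> e/8 * (2 * s)" using \<open>norm (w - z) \<le> 2 * s\<close> \<open>e > 0\<close> by (intro mult_left_mono) auto
        finally show ?thesis by simp
      qed
      have "f v - f w - L (v - w) = (f v - f z - L (v - z)) - (f w - f z - L (w - z))"
        using linear_diff[OF lin, of "v - z" "w - z"] by simp
      also have "cmod \<dots> \<le> cmod (f v - f z - L (v - z)) + cmod (f w - f z - L (w - z))" by (rule norm_triangle_ineq4)
      finally show ?thesis using *[OF that(1)] *[OF that(2)] by linarith
    qed
    have "cmod (rect_integral f x y (x+s) (y+s) - s *\<^sub>R ((- s) *\<^sub>R L \<i> + \<i> * (s *\<^sub>R L 1))) \<le> 2 * (e/2 * s) * s"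
    proof (rule rect_integral_square_bound)
      fix u assume "x \<le> u" "u \<le> x + s"
      then have m: "Complex u y \<in> square x y s" "Complex u (y+s) \<in> square x y s"
        using s by (auto simp: in_cbox_complex_iff)
      have "L (Complex u y - Complex u (y+s)) = (- s) *\<^sub>R L \<i>"
      proof -
        have "Complex u y - Complex u (y+s) = (- s) *\<^sub>R \<i>" by (simp add: complex_eq_iff)
        then show ?thesis by (simp only: linear_cmul[OF lin])
      qed
      with err[OF m] show "cmod (f (Complex u y) - f (Complex u (y + s)) - (- s) *\<^sub>R L \<i>) \<le> e/2 * s" by simp
    next
      fix v assume "y \<le> v" "v \<le> y + s"
      then have m: "Complex (x+s) v \<in> square x y s" "Complex x v \<in> square x y s"
        using s by (auto simp: in_cbox_complex_iff)
      have "L (Complex (x+s) v - Complex x v) = s *\<^sub>R L 1"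
      proof -
        have "Complex (x+s) v - Complex x v = s *\<^sub>R 1" by (simp add: complex_eq_iff)
        then show ?thesis by (simp only: linear_cmul[OF lin])
      qed
      with err[OF m] show "cmod (f (Complex (x+s) v) - f (Complex x v) - s *\<^sub>R L 1) \<le> e/2 * s" by simp
    qed (use s \<open>e > 0\<close> in auto)
    also have "s *\<^sub>R ((- s) *\<^sub>R L \<i> + \<i> * (s *\<^sub>R L 1)) = s\<^sup>2 *\<^sub>R (2 * \<i> * d)"
      unfolding L(2) by (simp add: algebra_simps power2_eq_square scaleR_conv_of_real)
    finally show "cmod (rect_integral f x y (x+s) (y+s) - s\<^sup>2 *\<^sub>R (2 * \<i> * d)) \<le> e * s\<^sup>2"
      by (simp add: power2_eq_square mult_ac)
  qed (use \<delta> in auto)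
qed

text \<open>Green's formula on a square whose boundary misses the support of \<open>f\<close>. At
  points of \<open>P\<close> boundedness gives a contour integral of order s only, so the weighted
  form of the formula is used there.\<close>

theorem integral_dbar_eq_0:
  fixes f g :: "complex \<Rightarrow> complex"
  assumes P: "finite P" and bdd: "\<And>z. cmod (f z) \<le> B"
    and dbar: "\<And>z. z \<notin> P \<Longrightarrow> has_dbar f (g z) z"
    and supp: "\<And>z. z \<notin> ball a R \<Longrightarrow> f z = 0"
    and g: "integrable lebesgue g"
  shows "integral\<^sup>L lebesgue g = 0"
proof -
  have B0: "B \<ge> 0" using bdd[of 0] norm_ge_zero order_trans by blast
  have fm: "f \<in> borel_measurable borel"
  proof (rule borel_measurable_continuous_countable_exceptions)
    show "countable P" using P by (rule countable_finite)
    show "continuous_on (- P) f"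
      by (intro continuous_at_imp_continuous_on ballI has_dbar_continuous[OF dbar]) auto
  qed
  have line: "(\<lambda>t. f (\<gamma> t)) integrable_on {c..d}" if "\<gamma> \<in> borel_measurable borel" for \<gamma> :: "real \<Rightarrow> complex" and c d
  proof (rule measurable_bounded_by_integrable_imp_integrable)
    show "(\<lambda>t. f (\<gamma> t)) \<in> borel_measurable (lebesgue_on {c..d})"
      by (intro measurable_restrict_space1 measurable_completion)
        (use measurable_compose[OF that fm] in simp)
    show "(\<lambda>t. B) integrable_on {c..d}"
      by (intro integrable_continuous_interval continuous_intros)
  qed (use bdd in auto)
  interpret line_integrable f
  proof
    show "(\<lambda>x. f (Complex x y)) integrable_on {c..d}" for y c d
      by (rule line) (auto simp: Complex_eq)
    show "(\<lambda>y. f (Complex x y)) integrable_on {c..d}" for x c d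
      by (rule line) (auto simp: Complex_eq)
  qed
  define s where "s = 2 * (\<bar>R\<bar> + 1)"
  define x y where "x = Re a - (\<bar>R\<bar> + 1)" and "y = Im a - (\<bar>R\<bar> + 1)"
  have s: "s > 0" by (simp add: s_def)
  let ?S = "square x y s"
  \<comment> \<open>near \<open>p \<in> P\<close> the integral of \<open>\<nu>\<close> over a square of side \<open>s\<close> has order \<open>s\<^sup>1\<^sup>/\<^sup>2\<close>,
    which dominates the boundary integral, of order \<open>s\<close>\<close>
  define \<nu> where "\<nu> = (\<lambda>z. 1 + (\<Sum>p\<in>P. cmod (z - p) powr (-(3/2))))"
  have \<nu>: "\<nu> integrable_on cbox u v" for u v unfolding \<nu>_def
    by (intro integrable_add integrable_const integrable_sum P
        set_lebesgue_integral_eq_integral(1)[OF kernel_absolutely_integrable]) auto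
  have \<nu>_ge: "\<nu> w \<ge> 1" for w unfolding \<nu>_def by (simp add: sum_nonneg)
  have int_ge: "c * s\<^sup>2 \<le> integral (square x y s) \<nu>"
    if "\<And>w. w \<in> square x y s \<Longrightarrow> w \<notin> P \<Longrightarrow> c \<le> \<nu> w" "s > 0" for c x y s
  proof -
    have "integral (square x y s) (\<lambda>w. c) = c * s\<^sup>2"
      using \<open>s > 0\<close> by (simp add: content_square del: content_cbox_if)
    moreover have "integral (square x y s) (\<lambda>w. c) \<le> integral (square x y s) (\<lambda>w. if w \<in> P then c else \<nu> w)"
      using that integrable_spike_finite[OF P _ \<nu>, of _ _ "\<lambda>w. if w \<in> P then c else \<nu> w"]
      by (intro integral_le) auto
    moreover have "integral (square x y s) (\<lambda>w. if w \<in> P then c else \<nu> w) = integral (square x y s) \<nu>"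
      by (rule integral_spike[OF negligible_finite[OF P]]) auto
    ultimately show ?thesis by linarith
  qed
  have "rect_integral f x y (x+s) (y+s) = integral ?S (\<lambda>z. 2 * \<i> * g z)"
  proof (rule rect_integral_square[where \<nu> = \<nu>])
    have "(\<lambda>z. 2 * \<i> * g z) absolutely_integrable_on UNIV"
      using g by (simp add: set_integrable_def)
    then have "(\<lambda>z. 2 * \<i> * g z) absolutely_integrable_on ?S"
      by (rule set_integrable_subset) auto
    then show "(\<lambda>z. 2 * \<i> * g z) integrable_on ?S"
      using set_lebesgue_integral_eq_integral(1) by blast
  next
    fix z and e :: real assume "e > 0"
    show "\<exists>d>0. \<forall>x y s. 0 < s \<and> s < d \<and> z \<in> square x y s \<longrightarrow>
       cmod (rect_integral f x y (x+s) (y+s) - s\<^sup>2 *\<^sub>R (2 * \<i> * g z)) \<le> e * integral (square x y s) \<nu>"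
    proof (cases "z \<in> P")
      case False
      obtain \<delta> where \<delta>: "\<delta> > 0" "\<And>x y s. 0 < s \<Longrightarrow> s < \<delta> \<Longrightarrow> z \<in> square x y s \<Longrightarrow>
          cmod (rect_integral f x y (x+s) (y+s) - s\<^sup>2 *\<^sub>R (2 * \<i> * g z)) \<le> e * s\<^sup>2"
        using rect_integral_has_dbar[OF dbar[OF False] \<open>e > 0\<close>] by blast
      show ?thesis
      proof (intro exI[of _ \<delta>] conjI allI impI)
        fix x y s assume s: "0 < s \<and> s < \<delta> \<and> z \<in> square x y s"
        have "s\<^sup>2 \<le> integral (square x y s) \<nu>" using int_ge[of x y s 1] \<nu>_ge s by simp
        then have "e * s\<^sup>2 \<le> e * integral (square x y s) \<nu>" using \<open>e > 0\<close> by simp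
        with \<delta>(2)[of s x y] s
        show "cmod (rect_integral f x y (x+s) (y+s) - s\<^sup>2 *\<^sub>R (2 * \<i> * g z)) \<le> e * integral (square x y s) \<nu>"
          by linarith
      qed (rule \<delta>)
    next
      case True
      \<comment> \<open>For s < 1, \<open>A * s\<close> dominates both the contour integral, at most
        4Bs, and the area term. The bound sqrt s < e / (4A) turns it into at most e sqrt s / 4, and
        sqrt s / 4 is below the integral of the weight, since every point of the square is within 2s
        of \<open>z\<close>.\<close>
      define A where "A = 4 * B + 2 * cmod (g z) + 1"
      have A: "A > 0" using B0 by (simp add: A_def add_nonneg_pos)
      define \<delta> where "\<delta> = min 1 ((e / (4 * A))\<^sup>2)"
      have \<delta>: "\<delta> > 0" using \<open>e > 0\<close> A by (simp add: \<delta>_def)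
      show ?thesis
      proof (intro exI[of _ \<delta>] conjI allI impI)
        fix x y s assume s: "0 < s \<and> s < \<delta> \<and> z \<in> square x y s"
        then have s1: "s < 1" "s < (e / (4 * A))\<^sup>2" "s > 0" by (auto simp: \<delta>_def)
        have "cmod (rect_integral f x y (x+s) (y+s) - s *\<^sub>R (0 + \<i> * 0)) \<le> 2 * (2 * B) * s"
        proof (rule rect_integral_square_bound)
          show "cmod (f (Complex u y) - f (Complex u (y + s)) - 0) \<le> 2 * B" for u
            using norm_triangle_ineq4[of "f (Complex u y)" "f (Complex u (y + s))"]
              bdd[of "Complex u y"] bdd[of "Complex u (y + s)"] by simp
          show "cmod (f (Complex (x + s) v) - f (Complex x v) - 0) \<le> 2 * B" for v
            using norm_triangle_ineq4[of "f (Complex (x + s) v)" "f (Complex x v)"]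
              bdd[of "Complex (x + s) v"] bdd[of "Complex x v"] by simp
        qed (use s B0 in auto)
        then have "cmod (rect_integral f x y (x+s) (y+s) - s\<^sup>2 *\<^sub>R (2 * \<i> * g z)) \<le> 4 * B * s + s\<^sup>2 * (2 * cmod (g z))"
          using norm_triangle_ineq4[of "rect_integral f x y (x+s) (y+s)" "s\<^sup>2 *\<^sub>R (2 * \<i> * g z)"]
          by (simp add: norm_mult)
        also have "\<dots> \<le> 4 * B * s + s * (2 * cmod (g z))"
          using s1 by (intro add_left_mono mult_right_mono) (auto simp: power2_eq_square mult_left_le)
        also have "\<dots> \<le> A * s" using s1 by (simp add: A_def algebra_simps)
        also have "A * s \<le> e * ((2 * s) powr (-(3/2)) * s\<^sup>2)"
        proof -
          have "sqrt s < e / (4 * A)" using s1 \<open>e > 0\<close> A by (intro real_less_lsqrt) auto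
          then have "4 * A * sqrt s \<le> e" using A by (simp add: field_simps)
          then have "4 * A * sqrt s * (sqrt s / 4) \<le> e * (sqrt s / 4)"
            using s1 by (intro mult_right_mono) auto
          then have "A * s \<le> e * (sqrt s / 4)" using s1 by simp
          also have "sqrt s / 4 \<le> (2 * s) powr (-(3/2)) * s\<^sup>2"
          proof -
            have "s powr (-(3/2)) * s\<^sup>2 = s powr (-(3/2)) * s powr 2" using s1 by simp
            also have "\<dots> = s powr (1/2)" by (simp add: powr_add[symmetric])
            also have "\<dots> = sqrt s" using s1 by (simp add: powr_half_sqrt)
            finally have e1: "s powr (-(3/2)) * s\<^sup>2 = sqrt s" .
            have "1/4 = (2::real) powr (-2)" by (simp add: powr_minus)
            also have "\<dots> \<le> 2 powr (-(3/2))" by (intro powr_mono) auto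
            finally have "sqrt s / 4 \<le> 2 powr (-(3/2)) * sqrt s" 
              using mult_right_mono[of "1/4" "2 powr (-(3/2))" "sqrt s"] s1 by simp
            then show ?thesis using s1 by (simp add: powr_mult mult.assoc e1)
          qed
          finally show ?thesis using \<open>e > 0\<close> by simp
        qed
        also have "\<dots> \<le> e * integral (square x y s) \<nu>"
        proof (intro mult_left_mono int_ge)
          fix w assume w: "w \<in> square x y s" "w \<notin> P"
          have "cmod (w - z) \<le> 2 * s" using square_dist s w by blast
          moreover have "cmod (w - z) > 0" using w True by auto
          ultimately have "(2 * s) powr (-(3/2)) \<le> cmod (w - z) powr (-(3/2))"
            by (intro powr_mono2') auto
          also have "\<dots> \<le> (\<Sum>p\<in>P. cmod (w - p) powr (-(3/2)))"
            using True P by (intro member_le_sum) auto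
          finally show "(2 * s) powr (-(3/2)) \<le> \<nu> w" by (simp add: \<nu>_def)
        qed (use s \<open>e > 0\<close> in auto)
        finally show "cmod (rect_integral f x y (x+s) (y+s) - s\<^sup>2 *\<^sub>R (2 * \<i> * g z)) \<le> e * integral (square x y s) \<nu>" .
      qed (rule \<delta>)
    qed
  qed (use s \<nu> in auto)
  moreover have "rect_integral f x y (x+s) (y+s) = 0"
  proof -
    have out: "f w = 0" if "\<bar>Re w - Re a\<bar> = \<bar>R\<bar> + 1 \<or> \<bar>Im w - Im a\<bar> = \<bar>R\<bar> + 1" for w
    proof (rule supp)
      show "w \<notin> ball a R"
        using that abs_Re_le_cmod[of "w - a"] abs_Im_le_cmod[of "w - a"]
        by (auto simp: dist_norm norm_minus_commute)
    qed
    have "f (Complex u y) = 0" "f (Complex u (y + s)) = 0" "f (Complex x u) = 0" "f (Complex (x + s) u) = 0" for u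
      by (rule out; simp add: x_def y_def s_def)+
    then show ?thesis by (simp add: rect_integral_def)
  qed
  moreover have "integral\<^sup>L lebesgue g = integral ?S g"
  proof -
    have "AE z in lebesgue. g z = indicator ?S z *\<^sub>R g z"
    proof -
      \<comment> \<open>\<open>g\<close> is known only as a derivative off \<open>P\<close>. It
        vanishes outside the square because \<open>f\<close> is identically 0 near each point there
        and the derivative is unique.\<close>
      have "g z = indicator ?S z *\<^sub>R g z" if "z \<notin> P" for z
      proof (cases "z \<in> ?S")
        case False
        have zR: "z \<in> - cball a R"
        proof -
          have "\<bar>Re z - Re a\<bar> > \<bar>R\<bar> + 1 \<or> \<bar>Im z - Im a\<bar> > \<bar>R\<bar> + 1"
            using False by (auto simp: in_cbox_complex_iff x_def y_def s_def)
          then show ?thesis using abs_Re_le_cmod[of "z - a"] abs_Im_le_cmod[of "z - a"]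
            by (auto simp: dist_norm norm_minus_commute)
        qed
        have "has_dbar f 0 z"
          by (rule has_dbar_transform[OF has_dbar_const[of 0] _ zR]) (auto intro!: supp)
        then have "g z = 0" using has_dbar_unique dbar[OF that] by blast
        then show ?thesis by simp
      qed auto
      moreover have "AE z in lebesgue. z \<notin> P"
        using negligible_finite[OF P] by (intro AE_not_in) (simp add: negligible_iff_null_sets)
      ultimately show ?thesis by (auto elim: eventually_mono)
    qed
    moreover have gS: "g absolutely_integrable_on ?S"
      by (rule set_integrable_subset[where A = UNIV]) (use g in \<open>auto simp: set_integrable_def\<close>)
    ultimately have "integral\<^sup>L lebesgue g = (LINT z:?S|lebesgue. g z)"
      unfolding set_lebesgue_integral_def
      by (intro integral_cong_AE) (use g in \<open>auto simp: set_integrable_def\<close>)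
    then show ?thesis using set_lebesgue_integral_eq_integral(2)[OF gS] by simp
  qed
  ultimately show ?thesis by simp
qed

section \<open>The Cauchy--Pompeiu formula\<close>

lemma has_real_derivative_max_0_power2:
  "((\<lambda>t. (max 0 t)\<^sup>2) has_real_derivative 2 * max 0 t) (at t)" for t :: real
proof (cases t "0::real" rule: linorder_cases)
  case less
  have "((\<lambda>t. 0) has_real_derivative 0) (at t)" by simp
  then have "((\<lambda>t. (max 0 t)\<^sup>2) has_real_derivative 0) (at t)"
    by (rule has_field_derivative_transform_within_open[where S = "{..<0}"]) (use less in auto)
  then show ?thesis using less by simp
next
  case greater
  have "((\<lambda>t. t\<^sup>2) has_real_derivative 2 * t) (at t)"
    by (auto intro!: derivative_eq_intros)
  then have "((\<lambda>t. (max 0 t)\<^sup>2) has_real_derivative 2 * t) (at t)"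
    by (rule has_field_derivative_transform_within_open[where S = "{0<..}"]) (use greater in auto)
  then show ?thesis using greater by simp
next
  case equal
  have "((\<lambda>t::real. ((max 0 t)\<^sup>2 - (max 0 0)\<^sup>2) / (t - 0)) \<longlongrightarrow> 0) (at 0)"
  proof (rule Lim_null_comparison)
    show "((\<lambda>t::real. \<bar>t\<bar>) \<longlongrightarrow> 0) (at 0)" by (rule tendsto_rabs_zero) simp
    show "\<forall>\<^sub>F t in at 0. norm (((max 0 t)\<^sup>2 - (max 0 0)\<^sup>2) / (t - 0)) \<le> \<bar>t :: real\<bar>"
      by (rule always_eventually) (auto simp: max_def power2_eq_square)
  qed
  then show ?thesis using equal by (simp add: has_field_derivative_iff)
qed

text \<open>Equal to 1 up to s = 1 and to 0 from s = 2 on. Squaring each positive part removes its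
  corner, so the derivative \<open>bump'\<close> is continuous, bounded and explicit.\<close>

definition bump :: "real \<Rightarrow> real" where
  "bump s = (max 0 (1 - (max 0 (s - 1))\<^sup>2))\<^sup>2"

definition bump' :: "real \<Rightarrow> real" where
  "bump' s = - 4 * max 0 (1 - (max 0 (s - 1))\<^sup>2) * max 0 (s - 1)"

lemma has_real_derivative_bump: "(bump has_real_derivative bump' s) (at s)"
proof -
  have "((\<lambda>s. (max 0 (s - 1))\<^sup>2) has_real_derivative 2 * max 0 (s - 1) * 1) (at s)"
    by (rule DERIV_chain2[where f = "\<lambda>t. (max 0 t)\<^sup>2" and g = "\<lambda>s. s - 1", OF has_real_derivative_max_0_power2])
      (auto intro!: derivative_eq_intros)
  from DERIV_diff[OF DERIV_const[of 1] this]
  have "((\<lambda>s. 1 - (max 0 (s - 1))\<^sup>2) has_real_derivative - (2 * max 0 (s - 1))) (at s)"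
    by simp
  from DERIV_chain2[where f = "\<lambda>t. (max 0 t)\<^sup>2" and g = "\<lambda>s. 1 - (max 0 (s - 1))\<^sup>2",
      OF has_real_derivative_max_0_power2 this] show ?thesis
    unfolding bump_def[abs_def] bump'_def by (simp add: mult_ac)
qed

lemma bump_le_1: "s \<le> 1 \<Longrightarrow> bump s = 1" "s \<le> 1 \<Longrightarrow> bump' s = 0"
  by (auto simp: bump_def bump'_def)

lemma bump_ge_2:
  assumes "s \<ge> 2" shows "bump s = 0" "bump' s = 0"
proof -
  have "(s - 1)\<^sup>2 \<ge> 1" using assms by (simp add: one_le_power)
  then show "bump s = 0" "bump' s = 0" using assms by (auto simp: bump_def bump'_def)
qed

lemma bump_bounds: "0 \<le> bump s" "bump s \<le> 1"
proof -
  have "max 0 (1 - (max 0 (s - 1))\<^sup>2) \<le> (1::real)" by auto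
  then show "bump s \<le> 1" unfolding bump_def by (intro power_le_one) auto
qed (simp add: bump_def)

lemma bump'_nonpos: "bump' s \<le> 0"
  unfolding bump'_def by (simp add: mult_nonneg_nonneg)

lemma bump'_ge: "bump' s \<ge> - 4"
proof (cases "s \<le> 2")
  case True
  have "max 0 (1 - (max 0 (s - 1))\<^sup>2) * max 0 (s - 1) \<le> 1 * 1"
    using True by (intro mult_mono) auto
  then show ?thesis unfolding bump'_def by simp
qed (simp add: bump_ge_2)

lemma bump'_neg: assumes "1 < s" "s < 2" shows "bump' s < 0"
proof -
  have "(s - 1)\<^sup>2 < 1" using assms by (simp add: power_less_one_iff)
  then have "0 < (1 - (s - 1)\<^sup>2) * (s - 1)" using assms by simp
  moreover have "bump' s = - 4 * ((1 - (s - 1)\<^sup>2) * (s - 1))"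
    using assms \<open>(s - 1)\<^sup>2 < 1\<close> by (simp add: bump'_def algebra_simps)
  ultimately show ?thesis by linarith
qed

lemma continuous_bump': "continuous_on UNIV bump'"
  unfolding bump'_def[abs_def] by (intro continuous_intros)

text \<open>The value of this constant is \<open>\<pi>\<close>, but only its positivity matters.\<close>

definition bump_mass :: real where
  "bump_mass = - (LINT z|lebesgue. bump' ((cmod z)\<^sup>2))"

lemma bump'_measurable: "(\<lambda>z. bump' ((cmod (z - \<zeta>))\<^sup>2)) \<in> borel_measurable borel"
  by (intro borel_measurable_continuous_onI continuous_on_compose2[OF continuous_bump'] continuous_intros) auto

lemma integrable_bump': "integrable lebesgue (\<lambda>z. bump' ((cmod (z - \<zeta>))\<^sup>2))"
proof (rule Bochner_Integration.integrable_bound)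
  show "integrable lebesgue (\<lambda>z. indicator (cball \<zeta> 2) z *\<^sub>R (4::real))"
    using absolutely_integrable_on_const[of "cball \<zeta> 2" "4::real"]
    by (simp add: set_integrable_def lmeasurable_cball)
  show "(\<lambda>z. bump' ((cmod (z - \<zeta>))\<^sup>2)) \<in> borel_measurable lebesgue"
    using bump'_measurable by (intro measurable_completion) simp
  have "\<bar>bump' ((cmod (z - \<zeta>))\<^sup>2)\<bar> \<le> indicator (cball \<zeta> 2) z *\<^sub>R (4::real)" for z
  proof (cases "z \<in> cball \<zeta> 2")
    case True
    then show ?thesis using bump'_ge[of "(cmod (z - \<zeta>))\<^sup>2"] bump'_nonpos[of "(cmod (z - \<zeta>))\<^sup>2"] by simp
  next
    case False
    then have "cmod (z - \<zeta>) > 2" by (simp add: dist_norm norm_minus_commute)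
    then have "(cmod (z - \<zeta>))\<^sup>2 \<ge> 2\<^sup>2" by (intro power_mono) auto
    then show ?thesis by (simp add: bump_ge_2)
  qed
  then show "AE z in lebesgue. norm (bump' ((cmod (z - \<zeta>))\<^sup>2)) \<le> norm (indicator (cball \<zeta> 2) z *\<^sub>R (4::real))"
    by (intro AE_I2) (auto intro: order_trans[OF _ abs_ge_self])
qed

lemma integral_bump': "(LINT z|lebesgue. bump' ((cmod (z - \<zeta>))\<^sup>2)) = - bump_mass"
proof -
  have m: "(\<lambda>z. bump' ((cmod z)\<^sup>2)) \<in> borel_measurable borel"
    using bump'_measurable[of 0] by simp
  have "(LINT z|lebesgue. bump' ((cmod (z - \<zeta>))\<^sup>2)) = (LINT z|lborel. bump' ((cmod (z - \<zeta>))\<^sup>2))"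
    using bump'_measurable by (intro integral_completion) simp
  also have "\<dots> = (LINT z|distr lborel borel ((+) \<zeta>). bump' ((cmod (z - \<zeta>))\<^sup>2))"
    by (simp add: lborel_distr_plus)
  also have "\<dots> = (LINT z|lborel. bump' ((cmod (\<zeta> + z - \<zeta>))\<^sup>2))"
    using bump'_measurable by (intro integral_distr) auto
  also have "\<dots> = (LINT z|lborel. bump' ((cmod z)\<^sup>2))" by simp
  also have "\<dots> = (LINT z|lebesgue. bump' ((cmod z)\<^sup>2))"
    using m by (intro integral_completion[symmetric]) simp
  finally show ?thesis by (simp add: bump_mass_def)
qed

text \<open>The integrand -bump'(|z|^2) is nonnegative, and strictly positive on the open annulus 1
  < |z|^2 < 2. That annulus contains 6/5, so it is a nonempty open set and not negligible.\<close>

lemma bump_mass_pos: "bump_mass > 0"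
proof -
  have eq: "bump_mass = (LINT z|lebesgue. - bump' ((cmod z)\<^sup>2))" by (simp add: bump_mass_def)
  have i: "integrable lebesgue (\<lambda>z. - bump' ((cmod z)\<^sup>2))"
    using integrable_bump'[of 0] by simp
  have "bump_mass \<ge> 0" unfolding eq by (intro Bochner_Integration.integral_nonneg) (simp add: bump'_nonpos)
  moreover have "bump_mass \<noteq> 0"
  proof
    assume "bump_mass = 0"
    then have "AE z in lebesgue. - bump' ((cmod z)\<^sup>2) = 0"
      unfolding eq by (subst (asm) integral_nonneg_eq_0_iff_AE[OF i]) (auto simp: bump'_nonpos)
    moreover define S where "S = {z. 1 < (cmod z)\<^sup>2 \<and> (cmod z)\<^sup>2 < 2}"
    ultimately have "AE z in lebesgue. z \<notin> S"
      by (elim eventually_mono) (use bump'_neg in \<open>fastforce simp: S_def\<close>)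
    moreover have "open S" unfolding S_def
      by (intro open_Collect_conj open_Collect_less continuous_intros)
    ultimately have "negligible S"
      by (subst negligible_iff_null_sets) (auto simp: AE_iff_null_sets)
    moreover have "of_real (6/5) \<in> S" by (simp add: S_def power2_eq_square del: of_real_divide)
    ultimately show False using \<open>open S\<close> open_not_negligible by blast
  qed
  ultimately show ?thesis by simp
qed

text \<open>Instead of excising a small disc, subtract u(\<zeta>) times a cutoff centred at \<zeta>.
  The difference \<open>N\<close> vanishes at \<zeta>, so N / (z - \<zeta>) is bounded with bounded
  support and its zbar derivative has integral 0. In that derivative the cutoff contributes
  u(\<zeta>) bump'(|z - \<zeta>|^2), whose integral is -u(\<zeta>) \<open>bump_mass\<close>. The
  exceptional point \<open>a\<close> is where u / (z - a)^n will be singular.\<close>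

theorem Cauchy_Pompeiu:
  fixes u F :: "complex \<Rightarrow> complex"
  assumes bdd: "\<And>z. cmod (u z) \<le> B"
    and dbar: "\<And>z. z \<noteq> a \<Longrightarrow> has_dbar u (F z) z"
    and supp: "\<And>z. z \<notin> ball b R \<Longrightarrow> u z = 0"
    and \<zeta>: "\<zeta> \<noteq> a"
    and int: "integrable lebesgue (\<lambda>z. F z / (z - \<zeta>))"
  shows "(LINT z|lebesgue. F z / (z - \<zeta>)) = - bump_mass * u \<zeta>"
proof -
  define k where "k = (\<lambda>z. of_real (bump ((cmod (z - \<zeta>))\<^sup>2)) :: complex)"
  define k' where "k' = (\<lambda>z. of_real (bump' ((cmod (z - \<zeta>))\<^sup>2)) * (z - \<zeta>))"
  have k: "has_dbar k (k' z) z" for z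
    unfolding k_def k'_def by (rule has_dbar_radial[OF has_real_derivative_bump])
  define N where "N = (\<lambda>z. u z - u \<zeta> * k z)"
  have N: "has_dbar N (F z - u \<zeta> * k' z) z" if "z \<noteq> a" for z
    unfolding N_def using has_dbar_diff[OF dbar[OF that] has_dbar_mult[OF has_dbar_const[of "u \<zeta>"] k]]
    by simp
  have N0: "N \<zeta> = 0" by (simp add: N_def k_def bump_le_1)
  have B0: "B \<ge> 0" using bdd[of 0] norm_ge_zero order_trans by blast
  have NB: "cmod (N z) \<le> 2 * B" for z
  proof -
    have "cmod (N z) \<le> cmod (u z) + cmod (u \<zeta>) * cmod (k z)"
      unfolding N_def using norm_triangle_ineq4 by (metis norm_mult)
    also have "\<dots> \<le> B + B * 1"
      using bump_bounds B0 by (intro add_mono mult_mono bdd) (auto simp: k_def)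
    finally show ?thesis by simp
  qed
  obtain C e where Ce: "e > 0" "C \<ge> 0" "\<And>w. cmod (w - \<zeta>) < e \<Longrightarrow> cmod (N w - N \<zeta>) \<le> C * cmod (w - \<zeta>)"
    using has_dbar_bound_quotient[OF N[OF \<zeta>]] by blast
  have "(LINT z|lebesgue. F z / (z - \<zeta>) - u \<zeta> * of_real (bump' ((cmod (z - \<zeta>))\<^sup>2))) = 0"
  proof (rule integral_dbar_eq_0[where f = "\<lambda>z. N z / (z - \<zeta>)" and P = "{a, \<zeta>}"])
    show "finite {a, \<zeta>}" by simp
    show "cmod (N z / (z - \<zeta>)) \<le> max C (2 * B / e)" for z
    proof (cases "z = \<zeta> \<or> cmod (z - \<zeta>) < e")
      case True
      then have "cmod (N z) / cmod (z - \<zeta>) \<le> C"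
        using Ce(3)[of z] Ce(2) N0 by (cases "z = \<zeta>") (auto simp: field_simps)
      then show ?thesis by (simp add: norm_divide)
    next
      case False
      then have "cmod (N z) / cmod (z - \<zeta>) \<le> 2 * B / e"
        using NB Ce(1) B0 by (intro frac_le) auto
      then show ?thesis by (simp add: norm_divide)
    qed
  next
    fix z assume z: "z \<notin> {a, \<zeta>}"
    have "((\<lambda>z. inverse (z - \<zeta>)) has_field_derivative - inverse ((z - \<zeta>)\<^sup>2)) (at z)"
      using z by (auto intro!: derivative_eq_intros simp: power2_eq_square)
    from has_dbar_mult[OF N has_dbar_holomorphic[OF this]] z
    have "has_dbar (\<lambda>z. N z / (z - \<zeta>)) ((F z - u \<zeta> * k' z) * inverse (z - \<zeta>)) z"
      by (simp add: divide_inverse)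
    also have "(F z - u \<zeta> * k' z) * inverse (z - \<zeta>) = F z / (z - \<zeta>) - u \<zeta> * of_real (bump' ((cmod (z - \<zeta>))\<^sup>2))"
      using z by (simp add: k'_def field_simps)
    finally show "has_dbar (\<lambda>z. N z / (z - \<zeta>)) (F z / (z - \<zeta>) - u \<zeta> * of_real (bump' ((cmod (z - \<zeta>))\<^sup>2))) z" .
  next
    \<comment> \<open>The radius is chosen so that outside this disc both \<open>u\<close> vanishes
      and |z - \<zeta>| \<ge> 2, which puts \<open>z\<close> outside the support of the cutoff
      \<open>k\<close>.\<close>
    fix z assume z: "z \<notin> ball b (\<bar>R\<bar> + cmod (\<zeta> - b) + 2)"
    then have "z \<notin> ball b R" using norm_ge_zero[of "\<zeta> - b"] by (auto simp del: norm_ge_zero)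
    moreover have "cmod (z - b) \<le> cmod (z - \<zeta>) + cmod (\<zeta> - b)"
      using norm_triangle_ineq[of "z - \<zeta>" "\<zeta> - b"] by simp
    then have "cmod (z - \<zeta>) \<ge> 2" using z by (simp add: dist_norm norm_minus_commute)
    then have "(cmod (z - \<zeta>))\<^sup>2 \<ge> 2\<^sup>2" by (intro power_mono) auto
    ultimately show "N z / (z - \<zeta>) = 0" by (simp add: N_def k_def supp bump_ge_2)
  next
    show "integrable lebesgue (\<lambda>z. F z / (z - \<zeta>) - u \<zeta> * of_real (bump' ((cmod (z - \<zeta>))\<^sup>2)))"
      by (intro Bochner_Integration.integrable_diff int integrable_mult_right integrable_of_real integrable_bump')
  qed
  then have "(LINT z|lebesgue. F z / (z - \<zeta>)) = u \<zeta> * of_real (LINT z|lebesgue. bump' ((cmod (z - \<zeta>))\<^sup>2))"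
    by (subst (asm) Bochner_Integration.integral_diff)
      (auto simp: int integral_complex_of_real intro!: integrable_mult_right integrable_of_real integrable_bump')
  then show ?thesis by (simp add: integral_bump')
qed

section \<open>Carleman's estimate\<close>

lemma norm_integral_le:
  fixes f :: "'a \<Rightarrow> complex" and g :: "'a \<Rightarrow> real"
  assumes "integrable M f" "integrable M g" "AE x in M. cmod (f x) \<le> g x"
  shows "cmod (integral\<^sup>L M f) \<le> integral\<^sup>L M g"
proof -
  have "cmod (integral\<^sup>L M f) \<le> (LINT x|M. cmod (f x))" by (rule integral_norm_bound)
  also have "\<dots> \<le> integral\<^sup>L M g"
    using assms by (intro integral_mono_AE) auto
  finally show ?thesis .
qed

lemma AE_lebesgue_neq: "AE z in lebesgue. z \<noteq> (a :: complex)"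
  by (intro AE_completion) (rule AE_lborel_singleton)

text \<open>The left side is the modulus of 1/(z - \<zeta>) - 1/(z - a), kept in product form so
  that a factor |z - a| in the integrand can cancel.\<close>

lemma norm_kernel_diff_le:
  fixes z a \<zeta> :: complex
  assumes "z \<noteq> a" "z \<noteq> \<zeta>"
  shows "cmod (\<zeta> - a) / (cmod (z - a) * cmod (z - \<zeta>)) \<le> 1 / cmod (z - \<zeta>) + 1 / cmod (z - a)"
proof -
  have "cmod (\<zeta> - a) \<le> cmod (z - a) + cmod (z - \<zeta>)"
    using norm_triangle_ineq4[of "z - a" "z - \<zeta>"] by simp
  then have "cmod (\<zeta> - a) / (cmod (z - a) * cmod (z - \<zeta>))
      \<le> (cmod (z - a) + cmod (z - \<zeta>)) / (cmod (z - a) * cmod (z - \<zeta>))"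
    by (intro divide_right_mono) auto
  also have "\<dots> = 1 / cmod (z - \<zeta>) + 1 / cmod (z - a)"
    using assms by (simp add: field_simps)
  finally show ?thesis .
qed

text \<open>\<open>\<Phi>_ge\<close> lets \<Phi> absorb the derivative of the cutoff as well. In
  \<open>\<Phi>_le\<close> the quarter is calibrated against the constant \<open>bump_mass\<close>
  of the Cauchy--Pompeiu formula: two kernels, with poles \<zeta> and a, together cost half of it.
  \<open>Kato\<close> is smallness uniform in the pole, used to let the pole tend to a.\<close>

locale Carleman_estimate =
  fixes h D :: "complex \<Rightarrow> complex" and a :: complex and R :: real and \<Phi> :: "complex \<Rightarrow> real"
  assumes R: "R > 0"
    and dbar_h: "\<And>z. z \<in> ball a (2 * R) \<Longrightarrow> has_dbar h (D z) z"
    and ha: "h a = 0"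
    and \<Phi>_ge: "\<And>z. z \<in> ball a (2 * R) \<Longrightarrow> \<Phi> z \<ge> 1"
    and \<Phi>_out: "\<And>z. z \<notin> ball a (2 * R) \<Longrightarrow> \<Phi> z = 0"
    and D_le: "AE z in lebesgue. z \<in> ball a (2 * R) \<longrightarrow> cmod (D z) \<le> \<Phi> z * cmod (h z)"
    and \<Phi>_int: "\<And>\<zeta>. \<zeta> \<in> ball a (2 * R) \<Longrightarrow> integrable lebesgue (\<lambda>z. \<Phi> z / cmod (z - \<zeta>))"
    and \<Phi>_le: "\<And>\<zeta>. \<zeta> \<in> ball a (2 * R) \<Longrightarrow> (LINT z|lebesgue. \<Phi> z / cmod (z - \<zeta>)) \<le> bump_mass / 4"
    and Kato: "\<And>e. e > 0 \<Longrightarrow> \<exists>r>0. \<forall>\<zeta>\<in>ball a r. (LINT z:ball a r|lebesgue. \<Phi> z / cmod (z - \<zeta>)) \<le> e"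
begin

lemma a_in: "a \<in> ball a (2 * R)" using R by simp

lemma \<Phi>_nonneg: "\<Phi> z \<ge> 0"
  using \<Phi>_ge[of z] \<Phi>_out[of z] by (cases "z \<in> ball a (2 * R)") auto

definition \<psi> where "\<psi> z = (of_real (bump ((cmod (z - a))\<^sup>2 / R\<^sup>2)) :: complex)"
definition \<psi>' where "\<psi>' z = of_real (bump' ((cmod (z - a))\<^sup>2 / R\<^sup>2) / R\<^sup>2) * (z - a)"
definition u where "u z = \<psi> z * h z"
definition F where "F z = \<psi>' z * h z + \<psi> z * D z"

lemma dbar_\<psi>: "has_dbar \<psi> (\<psi>' z) z"
proof -
  have "((\<lambda>s. bump (s / R\<^sup>2)) has_real_derivative bump' ((cmod (z - a))\<^sup>2 / R\<^sup>2) * (1 / R\<^sup>2))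
      (at ((cmod (z - a))\<^sup>2))"
    by (rule DERIV_chain2[OF has_real_derivative_bump DERIV_cdivide[OF DERIV_ident]])
  from has_dbar_radial[OF this] show ?thesis
    by (simp add: \<psi>_def[abs_def] \<psi>'_def)
qed

lemma \<psi>_inside: "cmod (z - a) \<le> R \<Longrightarrow> \<psi> z = 1" "cmod (z - a) \<le> R \<Longrightarrow> \<psi>' z = 0"
proof -
  assume "cmod (z - a) \<le> R"
  then have "(cmod (z - a))\<^sup>2 \<le> R\<^sup>2" by (intro power_mono) auto
  then have "(cmod (z - a))\<^sup>2 / R\<^sup>2 \<le> 1" using R by simp
  then show "\<psi> z = 1" "\<psi>' z = 0" by (auto simp: \<psi>_def \<psi>'_def bump_le_1)
qed

text \<open>The cutoff is already 0 from sqrt 2 R on. The rational radius 3R/2 leaves a collar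
  inside \<open>ball a (2 * R)\<close>, so that \<open>h\<close> is bounded on the closed disc
  containing the support.\<close>

lemma \<psi>_outside: "cmod (z - a) \<ge> 3/2 * R \<Longrightarrow> \<psi> z = 0" "cmod (z - a) \<ge> 3/2 * R \<Longrightarrow> \<psi>' z = 0"
proof -
  assume "cmod (z - a) \<ge> 3/2 * R"
  then have "(cmod (z - a))\<^sup>2 \<ge> (3/2 * R)\<^sup>2" using R by (intro power_mono) auto
  moreover have "(3/2 * R)\<^sup>2 = 9/4 * R\<^sup>2" by (simp add: power2_eq_square)
  ultimately have "(cmod (z - a))\<^sup>2 \<ge> 2 * R\<^sup>2" using zero_le_power2[of R] by linarith
  then have "(cmod (z - a))\<^sup>2 / R\<^sup>2 \<ge> 2" using R by (simp add: pos_le_divide_eq)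
  then show "\<psi> z = 0" "\<psi>' z = 0" by (auto simp: \<psi>_def \<psi>'_def bump_ge_2)
qed

lemma norm_\<psi>: "cmod (\<psi> z) \<le> 1"
  using bump_bounds by (simp add: \<psi>_def)

lemma norm_\<psi>': "cmod (\<psi>' z) \<le> 6 / R"
proof (cases "cmod (z - a) \<ge> 3/2 * R")
  case True
  then show ?thesis using R by (simp add: \<psi>_outside)
next
  case False
  have "cmod (\<psi>' z) = \<bar>bump' ((cmod (z - a))\<^sup>2 / R\<^sup>2)\<bar> / R\<^sup>2 * cmod (z - a)"
    by (simp add: \<psi>'_def norm_mult norm_divide norm_power)
  also have "\<dots> \<le> 4 / R\<^sup>2 * (3/2 * R)"
    using False bump'_ge[of "(cmod (z - a))\<^sup>2 / R\<^sup>2"] bump'_nonpos[of "(cmod (z - a))\<^sup>2 / R\<^sup>2"]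
    by (intro mult_mono divide_right_mono) auto
  also have "\<dots> = 6 / R" using R by (simp add: power2_eq_square)
  finally show ?thesis .
qed

lemma u_outside: "cmod (z - a) \<ge> 3/2 * R \<Longrightarrow> u z = 0"
  by (simp add: u_def \<psi>_outside)

lemma dbar_u: "has_dbar u (F z) z"
proof (cases "z \<in> ball a (2 * R)")
  case True
  from has_dbar_mult[OF dbar_\<psi> dbar_h[OF True]] show ?thesis
    by (simp add: u_def[abs_def] F_def)
next
  case False
  then have z: "z \<in> - cball a (3/2 * R)" using R by (auto simp: dist_norm)
  then have "F z = 0" by (simp add: F_def \<psi>_outside dist_norm norm_minus_commute)
  moreover have "has_dbar u 0 z"
    by (rule has_dbar_transform[OF has_dbar_const[of 0] _ z])
      (auto simp: u_outside dist_norm norm_minus_commute)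
  ultimately show ?thesis by simp
qed

lemma u_measurable: "u \<in> borel_measurable borel"
  by (intro borel_measurable_continuous_onI continuous_at_imp_continuous_on ballI has_dbar_continuous[OF dbar_u])

lemma F_measurable: "F \<in> borel_measurable lebesgue"
  by (rule has_dbar_measurable[OF u_measurable]) (simp add: dbar_u)

definition H where "H = (SOME H. H \<ge> 0 \<and> (\<forall>z\<in>cball a (3/2 * R). cmod (h z) \<le> H))"

lemma H: "H \<ge> 0" "\<And>z. cmod (z - a) \<le> 3/2 * R \<Longrightarrow> cmod (h z) \<le> H"
proof -
  have "continuous_on (cball a (3/2 * R)) h"
    using R by (intro continuous_at_imp_continuous_on ballI has_dbar_continuous[OF dbar_h]) auto
  then have "compact (h ` cball a (3/2 * R))" by (intro compact_continuous_image) auto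
  then obtain B where "B > 0" "\<forall>z\<in>cball a (3/2 * R). cmod (h z) \<le> B"
    using compact_imp_bounded bounded_pos by (metis (no_types, lifting) imageI)
  then have "\<exists>H. H \<ge> 0 \<and> (\<forall>z\<in>cball a (3/2 * R). cmod (h z) \<le> H)" by (intro exI[of _ B]) auto
  from someI_ex[OF this] show "H \<ge> 0" "\<And>z. cmod (z - a) \<le> 3/2 * R \<Longrightarrow> cmod (h z) \<le> H"
    unfolding H_def[symmetric] by (auto simp: dist_norm norm_minus_commute)
qed

lemma norm_u: "cmod (u z) \<le> H"
proof (cases "cmod (z - a) \<le> 3/2 * R")
  case True
  then show ?thesis unfolding u_def norm_mult
    using mult_mono[OF norm_\<psi> H(2)[OF True], of z] by simp
qed (use H in \<open>simp add: u_outside\<close>)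

text \<open>The bound for the cutoff term \<psi>' h, from 6/R in \<open>norm_\<psi>'\<close> and the
  supremum bound \<open>H\<close>; no power n enters.\<close>

definition K where "K = 6 * H / R"

lemma K: "K \<ge> 0" using H R by (simp add: K_def)

text \<open>This is where independence of n originates. The term \<psi>' h lives only where |z - a|
  > R, and there every power of |z - a| / R is at least 1, as is \<Phi>, so the same
  \<open>K\<close> works for all n.\<close>

lemma F_le: "AE z in lebesgue. \<forall>n. cmod (F z) \<le> \<Phi> z * (cmod (u z) + K * (cmod (z - a) / R) ^ n)"
  using D_le
proof eventually_elim
  case (elim z)
  show ?case
  proof (cases "cmod (z - a) < 3/2 * R")
    case True
    then have z: "z \<in> ball a (2 * R)" using R by (simp add: dist_norm norm_minus_commute)
    have "cmod (\<psi>' z * h z) \<le> \<Phi> z * (K * (cmod (z - a) / R) ^ n)" for n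
    proof (cases "cmod (z - a) \<le> R")
      case False
      have "cmod (\<psi>' z * h z) \<le> 6 / R * H"
        unfolding norm_mult using True R by (intro mult_mono norm_\<psi>' H) auto
      also have "\<dots> = 1 * (K * 1)" by (simp add: K_def)
      also have "\<dots> \<le> \<Phi> z * (K * (cmod (z - a) / R) ^ n)"
        using False R K \<Phi>_ge[OF z] by (intro mult_mono mult_left_mono one_le_power) auto
      finally show ?thesis .
    qed (use \<Phi>_nonneg K R in \<open>simp add: \<psi>_inside\<close>)
    moreover have "cmod (\<psi> z * D z) \<le> \<Phi> z * cmod (u z)"
      unfolding u_def norm_mult using elim z mult_left_mono[of "cmod (D z)" "\<Phi> z * cmod (h z)" "cmod (\<psi> z)"]
      by (simp add: mult_ac)
    ultimately show ?thesis unfolding F_def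
      by (smt (verit) distrib_left norm_triangle_ineq)
  next
    case False
    then show ?thesis using \<Phi>_nonneg K R by (simp add: F_def \<psi>_outside)
  qed
qed

text \<open>The constant \<open>B\<close> matters only qualitatively: it makes the integrals and the
  supremum below finite. The conclusion contains \<open>K\<close> alone, so nothing accumulates when
  the step is repeated.\<close>

lemma vanishing_order_step:
  assumes B: "\<And>z. cmod (u z) \<le> B * cmod (z - a) ^ n" and B0: "B \<ge> 0"
    and zeros: "\<And>e. e > 0 \<Longrightarrow> \<exists>\<zeta>. \<zeta> \<noteq> a \<and> cmod (\<zeta> - a) < e \<and> h \<zeta> = 0"
  shows "cmod (u z) \<le> K * (cmod (z - a) / R) ^ Suc n"
proof -
  define U where "U z = u z / (z - a) ^ n" for z
  define G where "G z = F z / (z - a) ^ n" for z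
  define K' where "K' = K / R ^ Suc n"
  have K': "K' \<ge> 0" using K R by (simp add: K'_def)
  \<comment> \<open>At z = a with n > 0 the quotient is x / 0 = 0, so the bound survives there
    because B \<ge> 0.\<close>
  have U_le: "cmod (U z) \<le> B" for z
    using B[of z] B0 by (cases "(z - a) ^ n = 0") (auto simp: U_def norm_divide norm_power pos_divide_le_eq zero_power)
  have U_out: "U z = 0" if "z \<notin> ball a (2 * R)" for z
    using that R by (simp add: U_def u_outside dist_norm norm_minus_commute)
  have dbar_U: "has_dbar U (G z) z" if "z \<noteq> a" for z
  proof -
    have "(\<lambda>z. inverse ((z - a) ^ n)) field_differentiable (at z)"
      using that by (intro derivative_intros field_differentiable_inverse) auto
    then obtain d where "((\<lambda>z. inverse ((z - a) ^ n)) has_field_derivative d) (at z)"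
      unfolding field_differentiable_def by blast
    from has_dbar_mult[OF dbar_u has_dbar_holomorphic[OF this]] show ?thesis
      by (simp add: U_def[abs_def] G_def divide_inverse)
  qed
  have G_le: "AE z in lebesgue. cmod (G z) \<le> \<Phi> z * (cmod (U z) + K' * cmod (z - a))"
    using F_le AE_lebesgue_neq[of a]
  proof eventually_elim
    case (elim z)
    have "cmod (G z) = cmod (F z) / cmod (z - a) ^ n" by (simp add: G_def norm_divide norm_power)
    also have "\<dots> \<le> \<Phi> z * (cmod (u z) + K * (cmod (z - a) / R) ^ Suc n) / cmod (z - a) ^ n"
      by (intro divide_right_mono elim(1)[rule_format]) simp
    also have "\<dots> = \<Phi> z * (cmod (U z) + K' * cmod (z - a))"
      using elim(2) by (simp add: U_def K'_def norm_divide norm_power power_divide field_simps)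
    finally show ?case .
  qed
  define C where "C = B + K' * (2 * R)"
  have C0: "C \<ge> 0" using B0 K' R by (simp add: C_def)
  have G_le_C: "AE z in lebesgue. cmod (G z) \<le> C * \<Phi> z"
    using G_le
  proof eventually_elim
    case (elim z)
    have "\<Phi> z * (cmod (U z) + K' * cmod (z - a)) \<le> \<Phi> z * C"
    proof (cases "z \<in> ball a (2 * R)")
      case True
      then have "cmod (U z) + K' * cmod (z - a) \<le> C"
        unfolding C_def using K' by (intro add_mono U_le mult_left_mono) (auto simp: dist_norm norm_minus_commute)
      then show ?thesis using \<Phi>_nonneg by (rule mult_left_mono)
    qed (simp add: \<Phi>_out)
    then show ?case using elim by (simp add: mult.commute)
  qed
  have Gm: "G \<in> borel_measurable lebesgue"
  proof -
    have "(\<lambda>z. (z - a) ^ n) \<in> borel_measurable lebesgue" by (intro measurable_completion) simp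
    then show ?thesis unfolding G_def[abs_def] using F_measurable by (intro borel_measurable_divide) auto
  qed
  have G_int: "integrable lebesgue (\<lambda>z. G z / (z - \<zeta>))" if "\<zeta> \<in> ball a (2 * R)" for \<zeta>
  proof (rule Bochner_Integration.integrable_bound)
    show "integrable lebesgue (\<lambda>z. C * (\<Phi> z / cmod (z - \<zeta>)))"
      by (intro integrable_mult_right \<Phi>_int that)
    have "(\<lambda>z. z - \<zeta>) \<in> borel_measurable lebesgue" by (intro measurable_completion) simp
    then show "(\<lambda>z. G z / (z - \<zeta>)) \<in> borel_measurable lebesgue"
      using Gm by (intro borel_measurable_divide)
    show "AE z in lebesgue. norm (G z / (z - \<zeta>)) \<le> norm (C * (\<Phi> z / cmod (z - \<zeta>)))"
      using G_le_C
    proof eventually_elim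
      case (elim z)
      then have "cmod (G z) / cmod (z - \<zeta>) \<le> C * \<Phi> z / cmod (z - \<zeta>)" by (intro divide_right_mono) auto
      then show ?case using C0 \<Phi>_nonneg[of z] by (simp add: norm_divide abs_mult)
    qed
  qed
  have Pompeiu: "(LINT z|lebesgue. G z / (z - \<zeta>)) = - bump_mass * U \<zeta>"
    if "\<zeta> \<in> ball a (2 * R)" "\<zeta> \<noteq> a" for \<zeta>
    using U_le dbar_U U_out that(2) G_int[OF that(1)] by (rule Cauchy_Pompeiu)
  have diff_int: "(LINT z|lebesgue. G z / (z - \<zeta>)) - (LINT z|lebesgue. G z / (z - a))
      = (LINT z|lebesgue. G z / (z - \<zeta>) - G z / (z - a))"
    if "\<zeta> \<in> ball a (2 * R)" for \<zeta>
    by (rule Bochner_Integration.integral_diff[symmetric]) (intro G_int that a_in)+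
  have diff_norm: "cmod (G z / (z - \<zeta>) - G z / (z - a)) = cmod (G z) * (cmod (\<zeta> - a) / (cmod (z - a) * cmod (z - \<zeta>)))"
    if "z \<noteq> a" "z \<noteq> \<zeta>" for z \<zeta>
  proof -
    have "G z / (z - \<zeta>) - G z / (z - a) = G z * ((\<zeta> - a) / ((z - a) * (z - \<zeta>)))"
      using that by (simp add: field_simps)
    then show ?thesis by (simp add: norm_mult norm_divide)
  qed
  \<comment> \<open>At a further zero \<zeta> the formula gives 0, so up to sign this integral
    equals the difference of the integrals with poles \<zeta> and a. That difference tends to 0 with
    \<zeta> - a: \<open>Kato\<close> controls the disc of radius r, and outside it both poles are at
    distance at least r/2.\<close>
  have zero: "(LINT z|lebesgue. G z / (z - a)) = 0"
  proof -
    have "cmod (LINT z|lebesgue. G z / (z - a)) \<le> 0 + e" if "e > 0" for e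
    proof -
      define e' where "e' = e / (3 * (C + 1))"
      have e': "e' > 0" "C * (3 * e') \<le> e"
        using \<open>e > 0\<close> C0 by (auto simp: e'_def field_simps)
      obtain r where r: "r > 0" "\<And>\<zeta>. \<zeta> \<in> ball a r \<Longrightarrow> (LINT z:ball a r|lebesgue. \<Phi> z / cmod (z - \<zeta>)) \<le> e'"
        using Kato[OF e'(1)] by blast
      \<comment> \<open>r/2 keeps \<zeta> away from points outside \<open>ball a r\<close>, 2R keeps
        it in the domain, and the last term makes the outer contribution at most \<open>e'\<close>.
        The three contributions of size \<open>e'\<close> explain the 3 in
        \<open>e'\<close>.\<close>
      define \<eta> where "\<eta> = min (min (r/2) (2 * R)) (e' * r / (2 * bump_mass))"
      have "\<eta> > 0" using r R e' bump_mass_pos by (simp add: \<eta>_def)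
      then obtain \<zeta> where \<zeta>: "\<zeta> \<noteq> a" "cmod (\<zeta> - a) < \<eta>" "h \<zeta> = 0" using zeros by blast
      then have \<zeta>r: "cmod (\<zeta> - a) < r/2" and \<zeta>R: "\<zeta> \<in> ball a (2 * R)" and \<zeta>ball: "\<zeta> \<in> ball a r"
        and small: "2 * cmod (\<zeta> - a) / r * bump_mass \<le> e'"
        using r(1) bump_mass_pos by (auto simp: \<eta>_def dist_norm norm_minus_commute field_simps)
      let ?k = "\<lambda>\<zeta> z. \<Phi> z / cmod (z - \<zeta>)"
      let ?b = "\<lambda>z. C * (indicator (ball a r) z *\<^sub>R ?k \<zeta> z + indicator (ball a r) z *\<^sub>R ?k a z
          + 2 * cmod (\<zeta> - a) / r * ?k a z)"
      have int_b: "integrable lebesgue (\<lambda>z. indicator (ball a r) z *\<^sub>R ?k \<zeta> z)" if "\<zeta> \<in> ball a (2 * R)" for \<zeta>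
        by (intro integrable_mult_indicator \<Phi>_int that) auto
      have "- (LINT z|lebesgue. G z / (z - a)) = (LINT z|lebesgue. G z / (z - \<zeta>) - G z / (z - a))"
        using diff_int[OF \<zeta>R] Pompeiu[OF \<zeta>R \<zeta>(1)] \<zeta>(3) by (simp add: U_def u_def)
      then have "cmod (LINT z|lebesgue. G z / (z - a)) = cmod (LINT z|lebesgue. G z / (z - \<zeta>) - G z / (z - a))"
        by (metis norm_minus_cancel)
      also have "\<dots> \<le> (LINT z|lebesgue. ?b z)"
      proof (rule norm_integral_le)
        show "integrable lebesgue (\<lambda>z. G z / (z - \<zeta>) - G z / (z - a))"
          by (intro Bochner_Integration.integrable_diff G_int \<zeta>R a_in)
        show "integrable lebesgue ?b"
          by (intro integrable_mult_right Bochner_Integration.integrable_add int_b \<zeta>R a_in \<Phi>_int)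
        show "AE z in lebesgue. cmod (G z / (z - \<zeta>) - G z / (z - a)) \<le> ?b z"
          using G_le_C AE_lebesgue_neq[of a] AE_lebesgue_neq[of \<zeta>]
        proof eventually_elim
          case (elim z)
          let ?T = "cmod (\<zeta> - a) / (cmod (z - a) * cmod (z - \<zeta>))"
          have "\<Phi> z * ?T \<le> indicator (ball a r) z *\<^sub>R ?k \<zeta> z + indicator (ball a r) z *\<^sub>R ?k a z
              + 2 * cmod (\<zeta> - a) / r * ?k a z"
          proof (cases "z \<in> ball a r")
            case True
            have "\<Phi> z * ?T \<le> \<Phi> z * (1 / cmod (z - \<zeta>) + 1 / cmod (z - a))"
              using norm_kernel_diff_le[OF elim(2,3)] \<Phi>_nonneg by (rule mult_left_mono)
            also have "\<dots> = ?k \<zeta> z + ?k a z" by (simp add: distrib_left)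
            finally show ?thesis using True r(1) \<Phi>_nonneg[of z] by (simp add: add_increasing2)
          next
            case False
            then have "r \<le> cmod (z - a)" by (simp add: dist_norm norm_minus_commute)
            moreover have "cmod (z - a) \<le> cmod (z - \<zeta>) + cmod (\<zeta> - a)"
              using norm_triangle_ineq[of "z - \<zeta>" "\<zeta> - a"] by simp
            ultimately have "cmod (z - \<zeta>) \<ge> r/2" using \<zeta>r by linarith
            then have "cmod (\<zeta> - a) / (cmod (z - a) * cmod (z - \<zeta>)) \<le> cmod (\<zeta> - a) / (cmod (z - a) * (r/2))"
              using elim r(1) by (intro divide_left_mono mult_left_mono mult_pos_pos) auto
            then have "\<Phi> z * ?T \<le> \<Phi> z * (cmod (\<zeta> - a) / (cmod (z - a) * (r/2)))"
              using \<Phi>_nonneg by (rule mult_left_mono)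
            also have "\<dots> = 2 * cmod (\<zeta> - a) / r * ?k a z" by (simp add: field_simps)
            finally show ?thesis using False by simp
          qed
          then have "C * (\<Phi> z * ?T) \<le> ?b z" using C0 by (rule mult_left_mono)
          moreover have "cmod (G z) * ?T \<le> C * \<Phi> z * ?T" using elim(1) by (intro mult_right_mono) auto
          ultimately show ?case unfolding diff_norm[OF elim(2,3)] by (simp only: mult.assoc)
        qed
      qed
      also have "\<dots> = C * ((LINT z:ball a r|lebesgue. ?k \<zeta> z) + (LINT z:ball a r|lebesgue. ?k a z)
          + 2 * cmod (\<zeta> - a) / r * (LINT z|lebesgue. ?k a z))"
        unfolding set_lebesgue_integral_def
        by (intro has_bochner_integral_integral_eq has_bochner_integral_mult_right has_bochner_integral_add
            has_bochner_integral_integrable int_b \<zeta>R a_in \<Phi>_int)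
      also have "\<dots> \<le> C * (e' + e' + e')"
      proof (intro mult_left_mono add_mono C0)
        show "(LINT z:ball a r|lebesgue. ?k \<zeta> z) \<le> e'" "(LINT z:ball a r|lebesgue. ?k a z) \<le> e'"
          using r \<zeta>ball by auto
        have "2 * cmod (\<zeta> - a) / r * (LINT z|lebesgue. ?k a z) \<le> 2 * cmod (\<zeta> - a) / r * bump_mass"
          using \<Phi>_le[OF a_in] bump_mass_pos r(1) by (intro mult_left_mono) auto
        with small show "2 * cmod (\<zeta> - a) / r * (LINT z|lebesgue. ?k a z) \<le> e'" by linarith
      qed
      finally show ?thesis using e'(2) by simp
    qed
    then have "cmod (LINT z|lebesgue. G z / (z - a)) \<le> 0" by (rule field_le_epsilon)
    then show ?thesis by simp
  qed
  \<comment> \<open>Against the kernel difference the factor |z - a| cancels the pole at a and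
    leaves |\<zeta> - a| / |z - \<zeta>|, while the shift \<delta> is handled by
    \<open>norm_kernel_diff_le\<close>. Each of the two kernel integrals is at most
    \<open>bump_mass / 4\<close>, whence \<open>bump_mass / 2\<close>.\<close>
  have step: "bump_mass * cmod (U \<zeta>) \<le> (M + K') * (bump_mass / 2) * (cmod (\<zeta> - a) + \<delta>)"
    if M: "\<And>z. cmod (U z) \<le> M * (cmod (z - a) + \<delta>)" "M \<ge> 0" and "\<delta> > 0"
      and \<zeta>: "\<zeta> \<in> ball a (2 * R)" "\<zeta> \<noteq> a" for M \<delta> \<zeta>
  proof -
    let ?k = "\<lambda>\<zeta> z. \<Phi> z / cmod (z - \<zeta>)"
    let ?b = "\<lambda>z. (M + K') * ((cmod (\<zeta> - a) + \<delta>) * ?k \<zeta> z + \<delta> * ?k a z)"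
    have I1: "- bump_mass * U \<zeta> = (LINT z|lebesgue. G z / (z - \<zeta>) - G z / (z - a))"
      using diff_int[OF \<zeta>(1)] Pompeiu[OF \<zeta>] zero by simp
    have I2: "cmod (LINT z|lebesgue. G z / (z - \<zeta>) - G z / (z - a)) \<le> (LINT z|lebesgue. ?b z)"
    proof (rule norm_integral_le)
      show "integrable lebesgue (\<lambda>z. G z / (z - \<zeta>) - G z / (z - a))"
        by (intro Bochner_Integration.integrable_diff G_int \<zeta> a_in)
      show "integrable lebesgue ?b"
        by (intro integrable_mult_right Bochner_Integration.integrable_add \<zeta> a_in \<Phi>_int)
      show "AE z in lebesgue. cmod (G z / (z - \<zeta>) - G z / (z - a)) \<le> ?b z"
        using G_le AE_lebesgue_neq[of a] AE_lebesgue_neq[of \<zeta>]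
      proof eventually_elim
        case (elim z)
        let ?T = "cmod (\<zeta> - a) / (cmod (z - a) * cmod (z - \<zeta>))"
        have "cmod (U z) + K' * cmod (z - a) \<le> M * (cmod (z - a) + \<delta>) + K' * (cmod (z - a) + \<delta>)"
          using M(1) K' \<open>\<delta> > 0\<close> by (intro add_mono mult_left_mono) auto
        then have "\<Phi> z * (cmod (U z) + K' * cmod (z - a)) \<le> \<Phi> z * ((M + K') * (cmod (z - a) + \<delta>))"
          using \<Phi>_nonneg by (intro mult_left_mono) (auto simp: distrib_right)
        with elim(1) have "cmod (G z) \<le> \<Phi> z * ((M + K') * (cmod (z - a) + \<delta>))" by linarith
        then have "cmod (G z) * ?T \<le> \<Phi> z * ((M + K') * (cmod (z - a) + \<delta>)) * ?T"
          by (intro mult_right_mono) auto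
        also have "\<dots> = (M + K') * (cmod (\<zeta> - a) * ?k \<zeta> z + \<delta> * (\<Phi> z * ?T))"
          using elim(2,3) by (simp add: field_simps)
        also have "\<dots> \<le> (M + K') * (cmod (\<zeta> - a) * ?k \<zeta> z + \<delta> * (\<Phi> z * (1 / cmod (z - \<zeta>) + 1 / cmod (z - a))))"
          using norm_kernel_diff_le[OF elim(2,3)] \<Phi>_nonneg[of z] \<open>\<delta> > 0\<close> M(2) K'
          by (intro mult_left_mono add_left_mono) auto
        also have "\<dots> = ?b z" by (simp add: algebra_simps add_divide_distrib)
        finally show ?case unfolding diff_norm[OF elim(2,3)] .
      qed
    qed
    have "(LINT z|lebesgue. ?b z)
        = (M + K') * ((cmod (\<zeta> - a) + \<delta>) * (LINT z|lebesgue. ?k \<zeta> z) + \<delta> * (LINT z|lebesgue. ?k a z))"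
      by (intro has_bochner_integral_integral_eq has_bochner_integral_mult_right has_bochner_integral_add
          has_bochner_integral_integrable \<zeta> a_in \<Phi>_int)
    also have "\<dots> \<le> (M + K') * ((cmod (\<zeta> - a) + \<delta>) * (bump_mass / 4) + (cmod (\<zeta> - a) + \<delta>) * (bump_mass / 4))"
      using M(2) K' \<open>\<delta> > 0\<close> \<Phi>_le[OF \<zeta>(1)] \<Phi>_le[OF a_in] bump_mass_pos
      by (intro mult_left_mono add_mono mult_mono) (auto intro!: Bochner_Integration.integral_nonneg simp: \<Phi>_nonneg)
    finally have "cmod (- bump_mass * U \<zeta>) \<le> (M + K') * ((cmod (\<zeta> - a) + \<delta>) * (bump_mass / 4) + (cmod (\<zeta> - a) + \<delta>) * (bump_mass / 4))"
      unfolding I1 using I2 by linarith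
    then show ?thesis using bump_mass_pos by (simp add: norm_mult mult_ac)
  qed
  have U_small: "cmod (U z) \<le> K' * (cmod (z - a) + \<delta>)" if "\<delta> > 0" for \<delta> z
  proof -
    let ?q = "\<lambda>z. cmod (U z) / (cmod (z - a) + \<delta>)"
    \<comment> \<open>the shift by \<open>\<delta>\<close> makes the supremum finite; the resulting bound \<open>M \<le> K'\<close> does not depend on \<open>\<delta>\<close>\<close>
    define M where "M = (SUP z. ?q z)"
    have pos: "cmod (z - a) + \<delta> > 0" for z using \<open>\<delta> > 0\<close> by (simp add: add_nonneg_pos)
    have "?q z \<le> B / \<delta>" for z
      using U_le B0 \<open>\<delta> > 0\<close> by (intro frac_le) auto
    then have bdd: "bdd_above (range ?q)" by (intro bdd_aboveI2[where M = "B / \<delta>"])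
    have q_le: "?q z \<le> M" for z unfolding M_def by (rule cSUP_upper[OF _ bdd]) simp
    have M: "cmod (U z) \<le> M * (cmod (z - a) + \<delta>)" for z
      using pos[of z] q_le[of z] by (simp add: pos_divide_le_eq)
    have "?q a \<ge> 0" using \<open>\<delta> > 0\<close> by simp
    then have M0: "M \<ge> 0" using q_le[of a] by linarith
    \<comment> \<open>Since \<open>M\<close> is the least bound, the improved bound must dominate
      it. Finiteness of \<open>M\<close> is what permits solving for M \<le> K'.\<close>
    have "M \<le> (M + K') / 2" unfolding M_def
    proof (rule cSUP_least)
      fix \<zeta>
      show "?q \<zeta> \<le> ((SUP z. ?q z) + K') / 2"
      proof (cases "\<zeta> \<in> ball a (2 * R) \<and> \<zeta> \<noteq> a")
        case True
        have "bump_mass * cmod (U \<zeta>) \<le> bump_mass * ((M + K') / 2 * (cmod (\<zeta> - a) + \<delta>))"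
          using step[OF M M0 \<open>\<delta> > 0\<close>, of \<zeta>] True by (simp add: mult_ac)
        then have "cmod (U \<zeta>) \<le> (M + K') / 2 * (cmod (\<zeta> - a) + \<delta>)"
          using bump_mass_pos by (simp only: mult_le_cancel_left_pos)
        then show ?thesis using pos[of \<zeta>] unfolding M_def[symmetric] by (simp add: pos_divide_le_eq)
      next
        case False
        then have "U \<zeta> = 0" using U_out ha by (auto simp: U_def u_def)
        then show ?thesis using M0 K' unfolding M_def[symmetric] by simp
      qed
    qed simp
    then have "M \<le> K'" by simp
    then have "M * (cmod (z - a) + \<delta>) \<le> K' * (cmod (z - a) + \<delta>)"
      using pos[of z] by (intro mult_right_mono) auto
    with M[of z] show ?thesis by linarith
  qed
  have "cmod (U z) \<le> K' * cmod (z - a)"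
  proof (rule field_le_epsilon)
    fix e :: real assume "e > 0"
    have "cmod (U z) \<le> K' * (cmod (z - a) + e / (K' + 1))"
      using \<open>e > 0\<close> K' by (intro U_small) (simp add: add_nonneg_pos)
    also have "\<dots> = K' * cmod (z - a) + K' / (K' + 1) * e" by (simp add: algebra_simps)
    also have "K' / (K' + 1) * e \<le> 1 * e" using \<open>e > 0\<close> K' by (intro mult_right_mono) auto
    finally show "cmod (U z) \<le> K' * cmod (z - a) + e" by simp
  qed
  then have "cmod (U z) * cmod (z - a) ^ n \<le> K' * cmod (z - a) * cmod (z - a) ^ n"
    by (intro mult_right_mono) auto
  moreover have "cmod (u z) = cmod (U z) * cmod (z - a) ^ n"
    using ha by (cases "z = a") (auto simp: U_def u_def norm_divide norm_power)
  ultimately show ?thesis by (simp add: K'_def power_divide field_simps)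
qed

theorem vanishes_near_nonisolated_zero:
  assumes zeros: "\<And>e. e > 0 \<Longrightarrow> \<exists>\<zeta>. \<zeta> \<noteq> a \<and> cmod (\<zeta> - a) < e \<and> h \<zeta> = 0"
    and z: "z \<in> ball a R"
  shows "h z = 0"
proof -
  have bound: "\<exists>B\<ge>0. \<forall>z. cmod (u z) \<le> B * cmod (z - a) ^ n" for n
  proof (induction n)
    case 0
    then show ?case using norm_u H(1) by (intro exI[of _ H]) auto
  next
    case (Suc n)
    then obtain B where "B \<ge> 0" "\<And>z. cmod (u z) \<le> B * cmod (z - a) ^ n" by blast
    from vanishing_order_step[OF this(2,1) zeros]
    have "cmod (u z) \<le> K / R ^ Suc n * cmod (z - a) ^ Suc n" for z
      by (simp add: power_divide mult_ac)
    then show ?case using K R by (intro exI[of _ "K / R ^ Suc n"]) auto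
  qed
  define q where "q = cmod (z - a) / R"
  have q: "0 \<le> q" "q < 1" using z R by (auto simp: q_def dist_norm norm_minus_commute)
  have "cmod (u z) \<le> K * q ^ Suc n" for n
    using vanishing_order_step[OF _ _ zeros, of _ n z] bound[of n] unfolding q_def by blast
  moreover have "(\<lambda>n. K * q ^ Suc n) \<longlonglongrightarrow> K * 0"
    using q by (intro tendsto_intros LIMSEQ_Suc LIMSEQ_realpow_zero) auto
  ultimately have "cmod (u z) \<le> 0"
    by (intro LIMSEQ_le_const[of "\<lambda>n. K * q ^ Suc n"]) auto
  moreover have "\<psi> z = 1" using z by (intro \<psi>_inside) (auto simp: dist_norm norm_minus_commute)
  ultimately show ?thesis by (simp add: u_def)
qed

end

section \<open>Local integrability and null sets\<close>

text \<open>By Young's inequality f / |z - \<zeta>| is at most a small multiple of f^p plus a large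
  multiple of |z - \<zeta>|^(-q) with q = p/(p-1). Since p > 2 means q < 2, the second term has
  integral of order r^(2-q). First \<open>l\<close> makes the f^p part at most e/2, then the radius
  does the same for the kernel part, uniformly in the centre and the pole.\<close>

lemma Lp_Kato_class:
  fixes f :: "complex \<Rightarrow> real"
  assumes p: "p > 2" and f: "f \<in> borel_measurable lebesgue" "\<And>z. f z \<ge> 0"
    and int: "integrable lebesgue (\<lambda>z. f z powr p)" and e: "e > 0"
  shows "\<exists>r0>0. \<forall>r a \<zeta>. 0 < r \<and> r \<le> r0 \<and> \<zeta> \<in> ball a r \<longrightarrow>
    set_integrable lebesgue (ball a r) (\<lambda>z. f z / cmod (z - \<zeta>)) \<and>
    (LINT z:ball a r|lebesgue. f z / cmod (z - \<zeta>)) \<le> e"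
proof -
  define q where "q = 1 + 1 / (p - 1)"
  have q: "1 < q" "q < 2" using p by (auto simp: q_def)
  define A where "A = (LINT z|lebesgue. f z powr p)"
  have A: "A \<ge> 0" by (simp add: A_def)
  define l where "l = e / (2 * (A + 1))"
  have l: "l > 0" "l * A \<le> e / 2" using A e by (auto simp: l_def field_simps)
  define Q where "Q = 4 * 2 powr q / (1 - 2 powr (q - 2))"
  have "2 powr (q - 2) < 2 powr (0::real)" using q by (intro powr_less_mono) auto
  then have Q: "Q > 0" by (simp add: Q_def)
  define \<eta> where "\<eta> = e / (2 * l powr (1 - q) * Q)"
  have \<eta>: "\<eta> > 0" using e l Q by (simp add: \<eta>_def)
  \<comment> \<open>Solves (2 r0)^(2-q) = \<eta>; the 2 is there because \<open>ball a r\<close> is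
    enclosed in \<open>ball \<zeta> (2 * r)\<close>.\<close>
  define r0 where "r0 = \<eta> powr (1 / (2 - q)) / 2"
  have r0: "r0 > 0" using \<eta> by (simp add: r0_def)
  \<comment> \<open>Young's inequality for the conjugate exponents \<open>p\<close> and \<open>q\<close>, with constants that need not be optimal\<close>
  have young: "x * k \<le> l * x powr p + l powr (1 - q) * k powr q" if "x \<ge> 0" "k \<ge> 0" for x k :: real
  proof (cases "x = 0 \<or> k \<le> l * x powr (p - 1)")
    case True
    have "x * k \<le> l * x powr p"
    proof (cases "x = 0")
      case False
      then have "x * k \<le> x * (l * x powr (p - 1))" using True that by (intro mult_left_mono) auto
      also have "\<dots> = l * (x powr 1 * x powr (p - 1))" using that by simp
      also have "\<dots> = l * x powr p" unfolding powr_add[symmetric] by simp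
      finally show ?thesis .
    qed simp
    moreover have "0 \<le> l powr (1 - q) * k powr q" by simp
    ultimately show ?thesis by linarith
  next
    case False
    then have x: "x > 0" and k: "l * x powr (p - 1) < k" using that by auto
    then have k0: "k > 0" using l(1) by (smt (verit) mult_pos_pos powr_gt_zero)
    \<comment> \<open>Here the kernel factor dominates; solving for x gives the exponent 1/(p-1),
      which is q - 1.\<close>
    have "x powr (p - 1) \<le> k / l" using k l by (simp add: field_simps)
    then have "(x powr (p - 1)) powr (1 / (p - 1)) \<le> (k / l) powr (1 / (p - 1))"
      using p by (intro powr_mono2) auto
    then have "x \<le> (k / l) powr (q - 1)" using p x by (simp add: powr_powr q_def)
    then have "x * k \<le> (k / l) powr (q - 1) * k" using that by (intro mult_right_mono) auto
    also have "\<dots> = l powr (1 - q) * (k powr (q - 1) * k powr 1)"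
      using k0 l by (simp add: powr_divide powr_diff)
    also have "\<dots> = l powr (1 - q) * k powr q" unfolding powr_add[symmetric] by simp
    finally have "x * k \<le> l powr (1 - q) * k powr q" .
    moreover have "0 \<le> l * x powr p" using l by simp
    ultimately show ?thesis by linarith
  qed
  have main: "set_integrable lebesgue (ball a r) (\<lambda>z. f z / cmod (z - \<zeta>)) \<and>
      (LINT z:ball a r|lebesgue. f z / cmod (z - \<zeta>)) \<le> e"
    if r: "0 < r" "r \<le> r0" and \<zeta>: "\<zeta> \<in> ball a r" for r a \<zeta>
  proof -
    let ?g = "\<lambda>z. indicator (ball a r) z *\<^sub>R (f z / cmod (z - \<zeta>))"
    let ?k = "\<lambda>z. indicator (ball \<zeta> (2 * r)) z *\<^sub>R (cmod (z - \<zeta>) powr (-q))"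
    let ?b = "\<lambda>z. l * f z powr p + l powr (1 - q) * ?k z"
    have k_int: "integrable lebesgue ?k"
      using kernel_absolutely_integrable[of q "ball \<zeta> (2 * r)" \<zeta>] q by (simp add: set_integrable_def)
    have k_le: "(LINT z|lebesgue. ?k z) \<le> Q * (2 * r) powr (2 - q)"
    proof (rule integral_real_bounded)
      have "(\<integral>\<^sup>+z. ennreal (?k z) \<partial>lebesgue) = (\<integral>\<^sup>+w\<in>ball \<zeta> (2 * r). ennreal (cmod (w - \<zeta>) powr (-q)) \<partial>lebesgue)"
        by (intro nn_integral_cong) (auto simp: indicator_def)
      also have "\<dots> \<le> ennreal (Q * (2 * r) powr (2 - q))"
        using nn_integral_kernel_ball[of q "2 * r" \<zeta>] q r by (simp add: Q_def)
      finally show "(\<integral>\<^sup>+z. ennreal (?k z) \<partial>lebesgue) \<le> ennreal (Q * (2 * r) powr (2 - q))" .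
    qed (use Q in auto)
    have b_int: "integrable lebesgue ?b"
      by (intro Bochner_Integration.integrable_add integrable_mult_right int k_int)
    have g_le: "?g z \<le> ?b z" for z
    proof (cases "z \<in> ball a r")
      case True
      have "dist \<zeta> z < 2 * r" using True \<zeta> dist_triangle2[of \<zeta> z a] by (auto simp: dist_commute)
      then have z: "z \<in> ball \<zeta> (2 * r)" by simp
      have "(1 / cmod (z - \<zeta>)) powr q = cmod (z - \<zeta>) powr (-q)"
        by (simp add: powr_divide powr_minus_divide)
      then show ?thesis using young[of "f z" "1 / cmod (z - \<zeta>)"] f(2) True z by simp
    qed (use l f in auto)
    have g_int: "integrable lebesgue ?g"
    proof (rule Bochner_Integration.integrable_bound[OF b_int])
      have "(\<lambda>z. cmod (z - \<zeta>)) \<in> borel_measurable lebesgue" by (intro measurable_completion) simp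
      then show "?g \<in> borel_measurable lebesgue"
        by (intro borel_measurable_scaleR borel_measurable_indicator borel_measurable_divide f) auto
      have "0 \<le> ?g z" for z using f(2) by simp
      then show "AE z in lebesgue. norm (?g z) \<le> norm (?b z)"
        by (intro AE_I2) (metis abs_of_nonneg abs_ge_self g_le order_trans real_norm_def)
    qed
    have "(LINT z|lebesgue. ?g z) \<le> (LINT z|lebesgue. ?b z)"
      by (intro integral_mono g_int b_int g_le)
    also have "\<dots> = l * A + l powr (1 - q) * (LINT z|lebesgue. ?k z)"
      unfolding A_def
      by (intro has_bochner_integral_integral_eq has_bochner_integral_mult_right has_bochner_integral_add
          has_bochner_integral_integrable int k_int)
    also have "\<dots> \<le> e / 2 + l powr (1 - q) * (Q * \<eta>)"
    proof (intro add_mono mult_left_mono l(2))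
      have "(2 * r) powr (2 - q) \<le> (\<eta> powr (1 / (2 - q))) powr (2 - q)"
        using r q by (intro powr_mono2) (auto simp: r0_def)
      also have "\<dots> = \<eta>" using q \<eta> by (simp add: powr_powr)
      finally have "Q * (2 * r) powr (2 - q) \<le> Q * \<eta>" using Q by simp
      with k_le show "(LINT z|lebesgue. ?k z) \<le> Q * \<eta>" by linarith
    qed simp
    also have "\<dots> = e" using l(1) Q e by (simp add: \<eta>_def)
    finally show ?thesis using g_int by (simp add: set_integrable_def set_lebesgue_integral_def)
  qed
  show ?thesis using r0 main by (intro exI[of _ r0]) simp
qed

section \<open>Vanishing of the derivative almost everywhere on the zero set\<close>

lemma negligible_disjoint_translates:
  fixes E :: "'a::euclidean_space set"
  assumes E: "E \<in> sets lebesgue" "bounded E" and "c > 0"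
    and disj: "\<And>x y s. x \<in> E \<Longrightarrow> y \<in> E \<Longrightarrow> y = x + s *\<^sub>R e \<Longrightarrow> \<bar>s\<bar> < c \<Longrightarrow> s = 0"
  shows "negligible E"
proof -
  have Em: "E \<in> lmeasurable" using E bounded_set_imp_lmeasurable by blast
  \<comment> \<open>Infinitely many distinct shifts in (0, c): by \<open>disj\<close> the translates
    of \<open>E\<close> are pairwise disjoint, all of the same measure and all inside one ball, so
    that measure is 0.\<close>
  define t where "t k = c / real (k + 2)" for k :: nat
  have t: "0 < t k" "t k < c" for k using \<open>c > 0\<close> by (auto simp: t_def field_simps add_pos_nonneg)
  have tinj: "t j = t k \<Longrightarrow> j = k" for j k using \<open>c > 0\<close> by (simp add: t_def field_simps)
  let ?T = "\<lambda>k. (+) (t k *\<^sub>R e) ` E"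
  obtain b where b: "\<And>x. x \<in> E \<Longrightarrow> norm x \<le> b" using E(2) by (auto simp: bounded_iff)
  define V where "V = cball (0::'a) (b + c * norm e)"
  have sub: "?T k \<subseteq> V" for k
  proof
    fix w assume "w \<in> ?T k"
    then obtain x where x: "x \<in> E" "w = t k *\<^sub>R e + x" by auto
    have "norm w \<le> t k * norm e + norm x" using norm_triangle_ineq[of "t k *\<^sub>R e" x] x t(1)[of k] by simp
    also have "\<dots> \<le> c * norm e + b" using t[of k] b[OF x(1)] by (intro add_mono mult_right_mono) auto
    finally show "w \<in> V" by (simp add: V_def)
  qed
  have dis: "disjnt (?T j) (?T k)" if "j \<noteq> k" for j k
  proof (rule ccontr)
    assume "\<not> disjnt (?T j) (?T k)"
    then obtain x y where xy: "x \<in> E" "y \<in> E" "t j *\<^sub>R e + x = t k *\<^sub>R e + y" by (auto simp: disjnt_def)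
    then have "y = x + (t j - t k) *\<^sub>R e" by (simp add: algebra_simps)
    moreover have "\<bar>t j - t k\<bar> < c" using t[of j] t[of k] by linarith
    ultimately have "t j - t k = 0" using disj[OF xy(1,2)] by blast
    then show False using tinj that by simp
  qed
  have "real N * measure lebesgue E \<le> measure lebesgue V" for N
  proof -
    have "real N * measure lebesgue E = (\<Sum>k<N. measure lebesgue (?T k))"
      by (simp add: measure_translation)
    also have "\<dots> = measure lebesgue (\<Union>k<N. ?T k)"
      by (rule measure_UNION'[symmetric]) (use Em dis in \<open>auto simp: pairwise_def measurable_translation\<close>)
    also have "\<dots> \<le> measure lebesgue V"
      using sub Em by (intro measure_mono_fmeasurable) (auto simp: V_def measurable_translation fmeasurableD intro!: sets.finite_UN)
    finally show ?thesis .
  qed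
  then have "measure lebesgue E = 0"
    by (metis measure_nonneg order_le_less reals_Archimedean3 not_le)
  then show ?thesis using Em by (simp add: negligible_iff_measure)
qed

text \<open>If L e \<noteq> 0, then z is isolated among the zeros on the line through z in direction
  e. Sorting such points by a uniform isolation distance 1/(n+1) gives countably many sets to which
  \<open>negligible_disjoint_translates\<close> applies.\<close>

lemma negligible_zeros_nonzero_derivative:
  fixes f :: "'a::euclidean_space \<Rightarrow> 'b::real_normed_vector"
  assumes B: "compact B" "continuous_on B f" and e: "e \<noteq> 0"
  shows "negligible {z \<in> B. f z = 0 \<and> (\<exists>L. (f has_derivative L) (at z) \<and> L e \<noteq> 0)}" (is "negligible ?S")
proof -
  define Z where "Z = {z \<in> B. f z = 0}"
  have Z: "compact Z"
  proof -
    have "Z = B \<inter> f -` {0}" by (auto simp: Z_def)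
    then show ?thesis using continuous_closed_preimage[OF B(2) compact_imp_closed[OF B(1)], of "{0}"] B(1)
      by (metis closed_singleton compact_Int_closed inf.idem inf_assoc)
  qed
  define c where "c n = 1 / real (Suc n)" for n
  have c: "c n > 0" for n by (simp add: c_def)
  define E where "E n = {z \<in> Z. \<forall>t. t \<noteq> 0 \<and> \<bar>t\<bar> < c n \<longrightarrow> z + t *\<^sub>R e \<notin> Z}" for n
  have "negligible (E n)" for n
  proof (rule negligible_disjoint_translates)
    \<comment> \<open>Compact sets exhausting 0 < |t| < c n. They exhibit \<open>E n\<close> as the
      compact set \<open>Z\<close> minus countably many compact sets, hence as measurable.\<close>
    define T where "T m = {t. c m \<le> \<bar>t\<bar> \<and> \<bar>t\<bar> \<le> c n - c m}" for m
    have Tc: "compact (T m)" for m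
    proof -
      have "T m = {- (c n - c m)..c n - c m} \<inter> {t. c m \<le> \<bar>t\<bar>}" by (auto simp: T_def)
      moreover have "closed {t. c m \<le> \<bar>t :: real\<bar>}" by (intro closed_Collect_le continuous_intros)
      ultimately show ?thesis by (simp add: compact_Int_closed)
    qed
    have "E n = Z - (\<Union>m. (\<lambda>(y, t). y - t *\<^sub>R e) ` (Z \<times> T m))"
    proof (intro set_eqI iffI)
      fix z assume z: "z \<in> E n"
      have False if "y \<in> Z" "t \<in> T m" "z = y - t *\<^sub>R e" for m y t
      proof -
        have "t \<noteq> 0" "\<bar>t\<bar> < c n" using that(2) c[of m] by (auto simp: T_def)
        moreover have "z + t *\<^sub>R e \<in> Z" using that by simp
        ultimately show False using z by (auto simp: E_def)
      qed
      then show "z \<in> Z - (\<Union>m. (\<lambda>(y, t). y - t *\<^sub>R e) ` (Z \<times> T m))" using z by (auto simp: E_def)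
    next
      fix z assume z: "z \<in> Z - (\<Union>m. (\<lambda>(y, t). y - t *\<^sub>R e) ` (Z \<times> T m))"
      have "z + t *\<^sub>R e \<notin> Z" if t: "t \<noteq> 0" "\<bar>t\<bar> < c n" for t
      proof
        assume "z + t *\<^sub>R e \<in> Z"
        obtain m where "c m < min \<bar>t\<bar> (c n - \<bar>t\<bar>)"
          using t reals_Archimedean[of "min \<bar>t\<bar> (c n - \<bar>t\<bar>)"] by (auto simp: c_def inverse_eq_divide)
        then have "t \<in> T m" by (auto simp: T_def)
        then have "(\<lambda>(y, t). y - t *\<^sub>R e) (z + t *\<^sub>R e, t) \<in> (\<lambda>(y, t). y - t *\<^sub>R e) ` (Z \<times> T m)"
          using \<open>z + t *\<^sub>R e \<in> Z\<close> by blast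
        then show False using z by auto
      qed
      then show "z \<in> E n" using z by (auto simp: E_def)
    qed
    moreover have "closed ((\<lambda>(y, t). y - t *\<^sub>R e) ` (Z \<times> T m))" for m
      by (intro compact_imp_closed compact_continuous_image compact_Times Z Tc)
        (auto simp: case_prod_unfold intro!: continuous_intros)
    ultimately show "E n \<in> sets lebesgue"
      using Z by (auto intro!: sets.Diff sets.countable_UN simp: compact_imp_closed borel_closed)
    show "bounded (E n)"
      by (rule bounded_subset[OF compact_imp_bounded[OF Z]]) (auto simp: E_def)
    show "s = 0" if "x \<in> E n" "y \<in> E n" "y = x + s *\<^sub>R e" "\<bar>s\<bar> < c n" for x y s
      using that by (auto simp: E_def)
  qed (rule c)
  then have "negligible (\<Union>n. E n)" by (intro negligible_countable_Union) auto
  moreover have "?S \<subseteq> (\<Union>n. E n)"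
  proof
    fix z assume z: "z \<in> ?S"
    then obtain L where L: "(f has_derivative L) (at z)" "L e \<noteq> 0" by blast
    have lin: "linear L" using L(1) has_derivative_linear by blast
    \<comment> \<open>With this \<epsilon> the remainder along \<open>e\<close> is at most half of
      |t| |L e|, so it cannot cancel the linear term.\<close>
    define \<epsilon> where "\<epsilon> = norm (L e) / (2 * norm e)"
    have "\<epsilon> > 0" using L(2) e by (simp add: \<epsilon>_def)
    then obtain d where d: "d > 0" "\<And>w. norm (w - z) < d \<Longrightarrow> norm (f w - f z - L (w - z)) \<le> \<epsilon> * norm (w - z)"
      using L(1) unfolding has_derivative_at_alt by blast
    obtain n where n: "c n < d / norm e"
      using reals_Archimedean[of "d / norm e"] d e by (auto simp: c_def inverse_eq_divide)
    have "z + t *\<^sub>R e \<notin> Z" if t: "t \<noteq> 0" "\<bar>t\<bar> < c n" for t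
    proof
      assume "z + t *\<^sub>R e \<in> Z"
      then have f0: "f (z + t *\<^sub>R e) = 0" "f z = 0" using z by (auto simp: Z_def)
      have "\<bar>t\<bar> < d / norm e" using t n by linarith
      then have "norm (z + t *\<^sub>R e - z) < d" using e by (simp add: field_simps)
      from d(2)[OF this] have "norm (L (t *\<^sub>R e)) \<le> \<epsilon> * (\<bar>t\<bar> * norm e)" using f0 by simp
      then have "\<bar>t\<bar> * norm (L e) \<le> \<bar>t\<bar> * norm (L e) / 2"
        using e by (simp add: linear_cmul[OF lin] \<epsilon>_def)
      then show False using t L(2) by simp
    qed
    then show "z \<in> (\<Union>n. E n)" using z by (auto simp: E_def Z_def)
  qed
  ultimately show ?thesis by (rule negligible_subset)
qed

lemma AE_dbar_eq_0_on_zeros: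
  assumes B: "compact B" and dbar: "\<And>z. z \<in> B \<Longrightarrow> has_dbar h (D z) z"
  shows "AE z in lebesgue. z \<in> B \<longrightarrow> h z = 0 \<longrightarrow> D z = 0"
proof -
  let ?S = "\<lambda>e. {z \<in> B. h z = 0 \<and> (\<exists>L. (h has_derivative L) (at z) \<and> L e \<noteq> 0)}"
  have cont: "continuous_on B h"
    by (intro continuous_at_imp_continuous_on ballI has_dbar_continuous[OF dbar])
  have "negligible (?S 1 \<union> ?S \<i>)"
    by (intro negligible_Un negligible_zeros_nonzero_derivative B cont) auto
  moreover have "{z \<in> B. h z = 0 \<and> D z \<noteq> 0} \<subseteq> ?S 1 \<union> ?S \<i>"
  proof
    fix z assume z: "z \<in> {z \<in> B. h z = 0 \<and> D z \<noteq> 0}"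
    then obtain L where L: "(h has_derivative L) (at z)" "D z = (L 1 + \<i> * L \<i>) / 2"
      using dbar[of z] unfolding has_dbar_def by blast
    with z have "L 1 \<noteq> 0 \<or> L \<i> \<noteq> 0" by auto
    with L(1) z show "z \<in> ?S 1 \<union> ?S \<i>" by blast
  qed
  ultimately have "{z \<in> B. h z = 0 \<and> D z \<noteq> 0} \<in> null_sets lebesgue"
    using negligible_subset negligible_iff_null_sets by blast
  then have "AE z in lebesgue. z \<notin> {z \<in> B. h z = 0 \<and> D z \<noteq> 0}" by (rule AE_not_in)
  then show ?thesis by eventually_elim blast
qed

section \<open>Reduction of the differential inequality to Carleman's estimate\<close>

lemma Limsup_at_right_0_linear_bound:
  assumes "Limsup (at_right 0) (\<lambda>t. ereal (G t / t)) < \<infinity>"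
  obtains M \<delta> where "M > 0" "\<delta> > 0" "\<And>t. 0 < t \<Longrightarrow> t < \<delta> \<Longrightarrow> G t \<le> M * t"
proof -
  obtain m where m: "Limsup (at_right 0) (\<lambda>t. ereal (G t / t)) < ereal m"
    using assms ereal_dense2 by (metis less_PInf_Ex_of_nat)
  then have "eventually (\<lambda>t. ereal (G t / t) < ereal m) (at_right 0)"
    by (rule Limsup_lessD)
  then obtain \<delta> where \<delta>: "\<delta> > 0" "\<And>t. 0 < t \<Longrightarrow> t < \<delta> \<Longrightarrow> G t / t < m"
    by (auto simp: eventually_at_right_field)
  show ?thesis
  proof (rule that[of "max m 1" \<delta>])
    fix t :: real assume t: "0 < t" "t < \<delta>"
    then have "G t \<le> m * t" using \<delta>(2)[OF t] by (simp add: field_simps)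
    also have "\<dots> \<le> max m 1 * t" using t by (intro mult_right_mono) auto
    finally show "G t \<le> max m 1 * t" .
  qed (use \<delta> in auto)
qed

theorem dbar_inequality_local:
  fixes U :: "complex set" and h :: "complex \<Rightarrow> complex"
    and \<phi> :: "complex \<Rightarrow> real" and G :: "real \<Rightarrow> real" and p :: real
  assumes U: "open U" and h: "h differentiable_on U" and p: "p > 2"
    and \<phi>: "\<phi> \<in> Lp_loc p U" "\<forall>z\<in>U. 0 \<le> \<phi> z"
    and G: "Limsup (at_right 0) (\<lambda>t. ereal (G t / t)) < \<infinity>"
    and le: "AE z in lebesgue. z \<in> U \<longrightarrow> cmod (dzbar h z) \<le> \<phi> z * G (cmod (h z))"
    and a: "a \<in> U" "h a = 0"
    and zeros: "\<And>e. e > 0 \<Longrightarrow> \<exists>\<zeta>. \<zeta> \<noteq> a \<and> cmod (\<zeta> - a) < e \<and> h \<zeta> = 0"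
  shows "\<exists>R>0. \<forall>z\<in>ball a R. h z = 0"
proof -
  have dbar: "has_dbar h (dzbar h z) z" if "z \<in> U" for z
    using h U that by (intro has_dbar_dzbar) (simp add: differentiable_on_eq_differentiable_at)
  obtain M \<delta> where M: "M > 0" "\<delta> > 0" "\<And>t. 0 < t \<Longrightarrow> t < \<delta> \<Longrightarrow> G t \<le> M * t"
    using Limsup_at_right_0_linear_bound[OF G] by blast
  obtain \<rho>1 where \<rho>1: "\<rho>1 > 0" "cball a \<rho>1 \<subseteq> U" using U a(1) open_contains_cball by blast
  have "isCont h a" using has_dbar_continuous[OF dbar[OF a(1)]] .
  then obtain \<rho>2 where \<rho>2: "\<rho>2 > 0" "\<And>z. dist z a < \<rho>2 \<Longrightarrow> cmod (h z) < \<delta>"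
    using M(2) a(2) unfolding continuous_at_eps_delta by auto
  define \<rho> where "\<rho> = min \<rho>1 (\<rho>2 / 2)"
  have \<rho>: "\<rho> > 0" "cball a \<rho> \<subseteq> U" "\<And>z. z \<in> cball a \<rho> \<Longrightarrow> cmod (h z) < \<delta>"
    using \<rho>1 \<rho>2 by (auto simp: \<rho>_def dist_commute)
  \<comment> \<open>M \<phi> dominates the ratio |D| / |h| at the points of the disc where h
    \<noteq> 0, up to a null set. The summand 1 is added to meet the requirement \<Phi> \<ge> 1 of
    the estimate.\<close>
  define f where "f z = (if z \<in> cball a \<rho> then M * \<phi> z + 1 else 0)" for z
  have f0: "f z \<ge> 0" for z
  proof (cases "z \<in> cball a \<rho>")
    case True
    then have "0 \<le> M * \<phi> z" using M(1) \<phi>(2) \<rho>(2) by (intro mult_nonneg_nonneg) auto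
    then show ?thesis by (simp add: f_def)
  qed (simp add: f_def)
  have fm: "f \<in> borel_measurable lebesgue"
  proof -
    have "\<phi> \<in> borel_measurable (lebesgue_on (cball a \<rho>))"
    proof (rule measurable_restrict_mono)
      show "\<phi> \<in> borel_measurable (lebesgue_on U)" using \<phi>(1) by (simp add: Lp_loc_def)
    qed (rule \<rho>(2))
    then have "(\<lambda>z. M * \<phi> z + 1) \<in> borel_measurable (lebesgue_on (cball a \<rho>))"
      by (intro borel_measurable_add borel_measurable_times) auto
    then show ?thesis unfolding f_def[abs_def] by (intro borel_measurable_if_I) auto
  qed
  have f_int: "integrable lebesgue (\<lambda>z. f z powr p)"
  proof (rule Bochner_Integration.integrable_bound)
    have "integrable lebesgue (\<lambda>z. indicator (cball a \<rho>) z *\<^sub>R (\<bar>\<phi> z\<bar> powr p))"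
      using \<phi>(1) \<rho>(2) compact_cball unfolding Lp_loc_def set_integrable_def by blast
    moreover have "integrable lebesgue (\<lambda>z. indicator (cball a \<rho>) z *\<^sub>R (1::real))"
      using absolutely_integrable_on_const[of "cball a \<rho>" "1::real"]
      by (simp add: set_integrable_def lmeasurable_cball)
    ultimately show "integrable lebesgue (\<lambda>z. (2 * M) powr p * (indicator (cball a \<rho>) z *\<^sub>R (\<bar>\<phi> z\<bar> powr p))
        + 2 powr p * (indicator (cball a \<rho>) z *\<^sub>R (1::real)))"
      by (intro Bochner_Integration.integrable_add integrable_mult_right)
    show "(\<lambda>z. f z powr p) \<in> borel_measurable lebesgue" using fm by measurable
    have "norm (f z powr p) \<le> (2 * M) powr p * (indicator (cball a \<rho>) z *\<^sub>R (\<bar>\<phi> z\<bar> powr p))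
        + 2 powr p * (indicator (cball a \<rho>) z *\<^sub>R (1::real))" for z
    proof (cases "z \<in> cball a \<rho>")
      case True
      then have \<phi>0: "\<phi> z \<ge> 0" using \<phi>(2) \<rho>(2) by auto
      \<comment> \<open>x + 1 \<le> max (2x) 2, and the p-th power of a maximum is at most the sum
        of the p-th powers.\<close>
      have "f z powr p \<le> (max (2 * M * \<phi> z) 2) powr p"
        using True f0[of z] p by (intro powr_mono2) (auto simp: f_def)
      also have "\<dots> \<le> (2 * M * \<phi> z) powr p + 2 powr p" by (simp add: max_def)
      also have "(2 * M * \<phi> z) powr p = (2 * M) powr p * \<phi> z powr p"
        using M(1) \<phi>0 by (intro powr_mult)
      finally show ?thesis using True \<phi>0 by simp
    qed (use p in \<open>simp add: f_def\<close>)
    then show "AE z in lebesgue. norm (f z powr p) \<le> norm ((2 * M) powr p * (indicator (cball a \<rho>) z *\<^sub>R (\<bar>\<phi> z\<bar> powr p))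
        + 2 powr p * (indicator (cball a \<rho>) z *\<^sub>R (1::real)))"
      by (intro AE_I2) (auto intro: order_trans[OF _ abs_ge_self])
  qed
  note kato = Lp_Kato_class[OF p fm f0 f_int]
  have "bump_mass / 4 > 0" using bump_mass_pos by simp
  then have "\<exists>r0>0. \<forall>r a \<zeta>. 0 < r \<and> r \<le> r0 \<and> \<zeta> \<in> ball a r \<longrightarrow>
      set_integrable lebesgue (ball a r) (\<lambda>z. f z / cmod (z - \<zeta>)) \<and>
      (LINT z:ball a r|lebesgue. f z / cmod (z - \<zeta>)) \<le> bump_mass / 4"
    by (rule kato)
  then obtain r0 where r0: "r0 > 0"
    "\<And>r \<zeta>. 0 < r \<Longrightarrow> r \<le> r0 \<Longrightarrow> \<zeta> \<in> ball a r \<Longrightarrow> set_integrable lebesgue (ball a r) (\<lambda>z. f z / cmod (z - \<zeta>))"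
    "\<And>r \<zeta>. 0 < r \<Longrightarrow> r \<le> r0 \<Longrightarrow> \<zeta> \<in> ball a r \<Longrightarrow> (LINT z:ball a r|lebesgue. f z / cmod (z - \<zeta>)) \<le> bump_mass / 4"
    by (elim exE conjE) simp
  define R where "R = min r0 \<rho> / 2"
  have R: "R > 0" "2 * R \<le> r0" "2 * R \<le> \<rho>" using r0(1) \<rho>(1) by (auto simp: R_def)
  have sub: "ball a (2 * R) \<subseteq> cball a \<rho>" using R by auto
  define \<Phi> where "\<Phi> z = (if z \<in> ball a (2 * R) then f z else 0)" for z
  have \<Phi>_ind: "(\<lambda>z. \<Phi> z / cmod (z - \<zeta>)) = (\<lambda>z. indicator (ball a (2 * R)) z *\<^sub>R (f z / cmod (z - \<zeta>)))" for \<zeta>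
    by (auto simp: \<Phi>_def)
  interpret Carleman_estimate h "dzbar h" a R \<Phi>
  proof
    show "R > 0" by fact
    show "h a = 0" by fact
    show "has_dbar h (dzbar h z) z" if "z \<in> ball a (2 * R)" for z
      using that sub \<rho>(2) by (intro dbar) blast
    show "1 \<le> \<Phi> z" if "z \<in> ball a (2 * R)" for z
    proof -
      have "z \<in> cball a \<rho>" using that sub by blast
      moreover have "M * \<phi> z \<ge> 0" using M(1) \<phi>(2) \<rho>(2) calculation by (intro mult_nonneg_nonneg) auto
      ultimately show ?thesis using that by (simp add: \<Phi>_def f_def)
    qed
    show "\<Phi> z = 0" if "z \<notin> ball a (2 * R)" for z using that by (simp add: \<Phi>_def)
    have "AE z in lebesgue. z \<in> cball a \<rho> \<longrightarrow> h z = 0 \<longrightarrow> dzbar h z = 0"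
      by (rule AE_dbar_eq_0_on_zeros) (use dbar \<rho>(2) in auto)
    with le show "AE z in lebesgue. z \<in> ball a (2 * R) \<longrightarrow> cmod (dzbar h z) \<le> \<Phi> z * cmod (h z)"
    proof eventually_elim
      case (elim z)
      show ?case
      proof
        assume zR: "z \<in> ball a (2 * R)"
        then have z: "z \<in> cball a \<rho>" "z \<in> U" using sub \<rho>(2) by auto
        show "cmod (dzbar h z) \<le> \<Phi> z * cmod (h z)"
        proof (cases "h z = 0")
          case False
          have "cmod (dzbar h z) \<le> \<phi> z * G (cmod (h z))" using elim z by simp
          also have "\<dots> \<le> \<phi> z * (M * cmod (h z))"
            using False \<rho>(3)[OF z(1)] \<phi>(2) z by (intro mult_left_mono M) auto
          also have "\<dots> \<le> \<Phi> z * cmod (h z)"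
            using zR z by (simp add: \<Phi>_def f_def algebra_simps)
          finally show ?thesis .
        qed (use elim z in simp)
      qed
    qed
    show "integrable lebesgue (\<lambda>z. \<Phi> z / cmod (z - \<zeta>))" if "\<zeta> \<in> ball a (2 * R)" for \<zeta>
      using r0(2)[of "2 * R" \<zeta>] that R unfolding \<Phi>_ind by (simp add: set_integrable_def)
    show "(LINT z|lebesgue. \<Phi> z / cmod (z - \<zeta>)) \<le> bump_mass / 4" if "\<zeta> \<in> ball a (2 * R)" for \<zeta>
      using r0(3)[of "2 * R" \<zeta>] that R unfolding \<Phi>_ind by (simp add: set_lebesgue_integral_def)
    show "\<exists>r>0. \<forall>\<zeta>\<in>ball a r. (LINT z:ball a r|lebesgue. \<Phi> z / cmod (z - \<zeta>)) \<le> e" if "e > 0" for e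
    proof -
      from kato[OF that] obtain r1 where r1: "r1 > 0"
        "\<And>r \<zeta>. 0 < r \<Longrightarrow> r \<le> r1 \<Longrightarrow> \<zeta> \<in> ball a r \<Longrightarrow> (LINT z:ball a r|lebesgue. f z / cmod (z - \<zeta>)) \<le> e"
        by (elim exE conjE) simp
      define r where "r = min r1 (2 * R)"
      have "(LINT z:ball a r|lebesgue. \<Phi> z / cmod (z - \<zeta>)) = (LINT z:ball a r|lebesgue. f z / cmod (z - \<zeta>))" for \<zeta>
        by (rule set_lebesgue_integral_cong) (auto simp: \<Phi>_def r_def)
      then show ?thesis using r1 R(1) by (intro exI[of _ r]) (auto simp: r_def)
    qed
  qed
  show ?thesis using vanishes_near_nonisolated_zero[OF zeros] R(1) by blast
qed

text \<open>Let \<open>W\<close> be the interior of the zero set in the component. A point of the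
  component that is a limit of \<open>W\<close> is a non-isolated zero, and the local result puts it
  in \<open>W\<close>. So \<open>W\<close> is open and relatively closed: it is the whole component,
  or it is empty and then every zero is isolated.\<close>

theorem corollary1p1:
  fixes U :: "complex set" and h :: "complex \<Rightarrow> complex"
    and \<phi> :: "complex \<Rightarrow> real" and G :: "real \<Rightarrow> real" and p :: real
  assumes "open U"
    and "h differentiable_on U"
    and "p > 2"
    and "\<phi> \<in> Lp_loc p U"
    and "\<forall>z\<in>U. 0 \<le> \<phi> z"
    and "\<forall>t\<ge>0. 0 \<le> G t"
    and "G \<in> Lp_loc 1 {0..}"
    and "Limsup (at_right 0) (\<lambda>t. ereal (G t / t)) < \<infinity>"
    and "AE z in lebesgue. z \<in> U \<longrightarrow> cmod (dzbar h z) \<le> \<phi> z * G (cmod (h z))"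
  shows "\<forall>C\<in>components U. (\<exists>z\<in>C. h z = 0) \<longrightarrow>
           (\<forall>z\<in>C. h z = 0) \<or> (\<forall>z\<in>C. h z = 0 \<longrightarrow> z isolated_in {w\<in>C. h w = 0})"
proof (intro ballI impI)
  fix C assume C: "C \<in> components U"
  have CU: "C \<subseteq> U" and Copen: "open C" and Cconn: "connected C"
    using C assms(1) in_components_subset open_components in_components_connected by auto
  have cont: "continuous_on C h"
    using differentiable_imp_continuous_on[OF assms(2)] CU continuous_on_subset by blast
  note local = dbar_inequality_local[OF assms(1-5,8,9)]
  define W where "W = {z \<in> C. \<exists>R>0. \<forall>w\<in>ball z R. h w = 0}"
  have nonisolated: "z \<in> W"
    if z: "z \<in> C" "h z = 0" and zeros: "\<And>e. e > 0 \<Longrightarrow> \<exists>\<zeta>\<in>C. \<zeta> \<noteq> z \<and> cmod (\<zeta> - z) < e \<and> h \<zeta> = 0" for z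
    unfolding W_def using z CU zeros local[of z] by blast
  have Wopen: "open W"
    unfolding open_contains_ball
  proof
    fix z assume "z \<in> W"
    then obtain R where R: "z \<in> C" "R > 0" "\<And>w. w \<in> ball z R \<Longrightarrow> h w = 0" by (auto simp: W_def)
    obtain s where s: "s > 0" "ball z s \<subseteq> C" using Copen R(1) open_contains_ball by blast
    have "ball z (min s R) \<subseteq> W"
    proof
      fix w assume w: "w \<in> ball z (min s R)"
      then have "ball w (R - dist z w) \<subseteq> ball z R" by (simp add: ball_subset_ball_iff dist_commute)
      then show "w \<in> W" using w s R(3) unfolding W_def by (auto intro!: exI[of _ "R - dist z w"])
    qed
    then show "\<exists>e>0. ball z e \<subseteq> W" using s R(2) by (intro exI[of _ "min s R"]) auto
  qed
  have CWopen: "open (C - W)"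
    unfolding open_contains_ball
  proof (rule ballI, rule ccontr)
    fix z assume z: "z \<in> C - W" and no: "\<not> (\<exists>e>0. ball z e \<subseteq> C - W)"
    \<comment> \<open>A point outside \<open>W\<close> all of whose neighbourhoods meet
      \<open>W\<close> is approached by zeros different from itself.\<close>
    have near: "\<exists>\<zeta>\<in>C. \<zeta> \<noteq> z \<and> cmod (\<zeta> - z) < e \<and> h \<zeta> = 0" if "e > 0" for e
    proof -
      obtain s where s: "s > 0" "ball z s \<subseteq> C" using Copen z open_contains_ball by blast
      have "\<not> ball z (min e s) \<subseteq> C - W" using no that s(1) by auto
      then obtain w where w: "w \<in> ball z (min e s)" "w \<notin> C - W" by blast
      then have "w \<in> W" "w \<noteq> z" using s z by auto
      then show ?thesis
        using w s by (intro bexI[of _ w]) (auto simp: W_def dist_norm norm_minus_commute)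
    qed
    have "h z = 0"
    proof (rule ccontr)
      assume "h z \<noteq> 0"
      have "isCont h z" using cont Copen z continuous_on_eq_continuous_at by blast
      from continuous_at_avoid[OF this, of 0] \<open>h z \<noteq> 0\<close>
      obtain e where "e > 0" "\<And>y. dist z y < e \<Longrightarrow> h y \<noteq> 0" by auto
      with near[of e] show False by (auto simp: dist_norm norm_minus_commute)
    qed
    then show False using nonisolated[of z] near z by blast
  qed
  show "(\<forall>z\<in>C. h z = 0) \<or> (\<forall>z\<in>C. h z = 0 \<longrightarrow> z isolated_in {w\<in>C. h w = 0})"
  proof (cases "W = {}")
    case True
    have "z isolated_in {w\<in>C. h w = 0}" if z: "z \<in> C" "h z = 0" for z
    proof -
      obtain e where e: "e > 0" "\<And>\<zeta>. \<zeta> \<in> C \<Longrightarrow> cmod (\<zeta> - z) < e \<Longrightarrow> h \<zeta> = 0 \<Longrightarrow> \<zeta> = z"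
        using nonisolated[OF z] True by blast
      have "ball z e \<inter> {w\<in>C. h w = 0} = {z}"
        using e z by (auto simp: dist_norm norm_minus_commute)
      then show ?thesis using z by (intro isolated_inI[of _ _ "ball z e"]) auto
    qed
    then show ?thesis by blast
  next
    case False
    have "C - W = {}"
      using connectedD[OF Cconn Wopen CWopen] False by (auto simp: W_def)
    then have "C \<subseteq> W" by blast
    then show ?thesis by (force simp: W_def)
  qed
qed

end
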